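(* Let $T:E\to\mathcal{A}$ be a relative Rota--Baxter operator on a LieRep pair $(\mathcal{A},[\cdot,\cdot]_{\mathcal{A}},a_{\mathcal{A}};\rho)$. Then there is a one-to-one correspondence between the equivalence classes of infinitesimal deformations of $T$ and the first cohomology group $\mathcal{H}^1_T(E,\mathcal{A})$.
   Context: Vector bundles are smooth real vector bundles over a smooth manifold $M$, and bundle maps cover the identity of $M$. A Lie algebroid $(\mathcal{A},[\cdot,\cdot]_{\mathcal{A}},a_{\mathcal{A}})$ is a vector bundle $\mathcal{A}\to M$ with a Lie bracket on $\Gamma(\mathcal{A})$ and a bundle map $a_{\mathcal{A}}:\mathcal{A}\to TM$ with $[x,fy]_{\mathcal{A}}=f[x,y]_{\mathcal{A}}+a_{\mathcal{A}}(x)(f)y$. A representation of $\mathcal{A}$ on $E$ is a $C^\infty(M)$-linear map $x\mapsto\rho(x)$ from $\Gamma(\mathcal{A})$ to $\mathbb{R}$-linear operators on $\Gamma(E)$ with $\rho(x)(fu)=f\rho(x)u+a_{\mathcal{A}}(x)(f)u$ and $\rho([x,y]_{\mathcal{A}})=\rho(x)\rho(y)-\rho(y)\rho(x)$. A LieRep pair $(\mathcal{A};\rho)$ is a Lie algebroid with a representation $\rho$ on a vector bundle $E$. A relative Rota--Baxter operator is a bundle map $T:E\to\mathcal{A}$ with $[T(u),T(v)]_{\mathcal{A}}=T(\rho(T(u))(v)-\rho(T(v))(u))$ for all $u,v\in\Gamma(E)$. $\mathcal{C}^k(E,\mathcal{A})=\Gamma(\mathrm{Hom}(\wedge^kE,\mathcal{A}))$,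 $k\ge0$. For $P\in \mathcal{C}^n(E,\mathcal{A})$, $Q\in \mathcal{C}^m(E,\mathcal{A})$, $$\begin{aligned} [\![P,Q]\!](u_1,\dots,u_{m+n})={}&\sum_{\sigma\in\mathbb{S}_{(m,1,n-1)}} (-1)^\sigma P(\rho(Q(u_{\sigma(1)},\dots,u_{\sigma(m)}))u_{\sigma(m+1)},u_{\sigma(m+2)},\dots,u_{\sigma(m+n)})\\ &-(-1)^{mn}\sum_{\sigma\in\mathbb{S}_{(n,1,m-1)}} (-1)^\sigma Q(\rho(P(u_{\sigma(1)},\dots,u_{\sigma(n)}))u_{\sigma(n+1)},u_{\sigma(n+2)},\dots,u_{\sigma(m+n)})\\ &+(-1)^{mn}\sum_{\sigma\in\mathbb{S}_{(n,m)}} (-1)^\sigma [P(u_{\sigma(1)},\dots,u_{\sigma(n)}),Q(u_{\sigma(n+1)},\dots,u_{\sigma(m+n)})]_{\mathcal{A}}, \end{aligned}$$ where $\mathbb{S}_{(i_1,\dots,i_k)}$ is the set of unshuffles (permutations increasing on consecutive blocks of lengths $i_1,\dots,i_k$) and a sum involving a block of length $-1$ is zero. This is a graded Lie bracket. Put $\mathrm{d}_TP=(-1)^k[\![T,P]\!]$ for $P\in\mathcal{C}^k(E,\mathcal{A})$; then $\mathrm{d}_T^2=0$, and $\mathcal{H}^k_T(E,\mathcal{A})$ is the $k$-th cohomology group of $(\oplus_{k\ge0}\mathcal{C}^k(E,\mathcal{A}),\mathrm{d}_T)$. Extend all structures $\mathbb{R}[[t]]$-linearly. An order $n$ deformation of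 $T$ is $T_{(n)}=\sum_{i=0}^n\mathcal{T}_it^i$ with $\mathcal{T}_0=T$ and bundle maps $\mathcal{T}_i:E\to\mathcal{A}$ such that $T_{(n)}$ satisfies the relative Rota--Baxter identity modulo $t^{n+1}$ (i.e. over $\mathbb{R}[[t]]/(t^{n+1})$). An infinitesimal deformation is an order $1$ deformation. Two order $n$ deformations $T_t,T_t'$ are equivalent if there is a formal series $\mathcal{X}_t=\sum_{i\ge1}x_it^i$, $x_i\in\Gamma(\mathcal{A})=\mathcal{C}^0(E,\mathcal{A})$, with $\exp(\mathrm{ad}_{\mathcal{X}_t})T_t=T_t'$ modulo $t^{n+1}$, where $\exp(\mathrm{ad}_{\mathcal{X}_t})T_t=\sum_{k\ge0}\frac1{k!}\mathrm{ad}^k_{\mathcal{X}_t}T_t$ and $\mathrm{ad}_{\mathcal{X}_t}=[\![\mathcal{X}_t,\cdot]\!]$. *)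

theory Defs
  imports
    "HOL-Analysis.Analysis"
    "HOL-Combinatorics.Permutations"
    "HOL-Library.Function_Algebras"
begin

text \<open>Functions into a real vector space form a real vector space under the pointwise operations;
  the additive part is in \<^theory>\<open>HOL-Library.Function_Algebras\<close>. All sections, cochains, tangent
  vectors and coefficient sequences below are added and scaled in this sense.\<close>

instantiation "fun" :: (type, real_vector) real_vector
begin

definition scaleR_fun :: "real \<Rightarrow> ('a \<Rightarrow> 'b) \<Rightarrow> 'a \<Rightarrow> 'b"
  where "scaleR_fun c f = (\<lambda>x. c *\<^sub>R f x)"

instance
  by standard (auto simp: scaleR_fun_def fun_eq_iff scaleR_add_right scaleR_add_left)

end

lemma scaleR_fun_apply [simp]: "(c *\<^sub>R f) x = c *\<^sub>R f x"
  by (simp add: scaleR_fun_def)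


section \<open>Smooth manifolds\<close>

text \<open>\<open>\<real>\<^sup>n\<close> is the library's \<^const>\<open>Euclidean_space\<close>, i.e. the sequences vanishing from index \<open>n\<close> on,
  so that \<open>n = 0\<close> is allowed. Only its coordinates \<open>i < n\<close> are ever varied.\<close>

definition partial_deriv :: "nat \<Rightarrow> ((nat \<Rightarrow> real) \<Rightarrow> real) \<Rightarrow> (nat \<Rightarrow> real) \<Rightarrow> real"
  where "partial_deriv i f x = deriv (\<lambda>t. f (x(i := t))) (x i)"

text \<open>\<open>f\<close> is of class \<open>C\<^sup>k\<close> on the open subset \<open>U\<close> of \<open>\<real>\<^sup>n\<close>.\<close>

fun Ck_on :: "nat \<Rightarrow> nat \<Rightarrow> (nat \<Rightarrow> real) set \<Rightarrow> ((nat \<Rightarrow> real) \<Rightarrow> real) \<Rightarrow> bool"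
  where
    "Ck_on n 0 U f \<longleftrightarrow> continuous_on U f"
  | "Ck_on n (Suc k) U f \<longleftrightarrow> continuous_on U f \<and>
       (\<forall>i<n. (\<forall>x\<in>U. \<exists>d. ((\<lambda>t. f (x(i := t))) has_real_derivative d) (at (x i))) \<and>
              Ck_on n k U (partial_deriv i f))"

text \<open>A manifold is a Hausdorff second countable topological space, given as a type of the
  corresponding classes, with a smooth atlas of charts \<open>(U, \<phi>)\<close>.\<close>

record 'm manifold =
  mdim :: nat
  atlas :: "('m set \<times> ('m \<Rightarrow> nat \<Rightarrow> real)) set"

definition smooth_on :: "'m manifold \<Rightarrow> 'm set \<Rightarrow> ('m \<Rightarrow> real) \<Rightarrow> bool"
  where "smooth_on M W f \<longleftrightarrow>
    (\<forall>(U, \<phi>) \<in> atlas M. \<forall>k. Ck_on (mdim M) k (\<phi> ` (U \<inter> W)) (f \<circ> inv_into U \<phi>))"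

definition smooth_manifold :: "'m::{t2_space, second_countable_topology} manifold \<Rightarrow> bool"
  where "smooth_manifold M \<longleftrightarrow>
    (\<Union>(U, \<phi>) \<in> atlas M. U) = UNIV \<and>
    (\<forall>(U, \<phi>) \<in> atlas M.
       open U \<and> openin (Euclidean_space (mdim M)) (\<phi> ` U) \<and>
       homeomorphic_map (top_of_set U) (subtopology (Euclidean_space (mdim M)) (\<phi> ` U)) \<phi> \<and>
       (\<forall>i < mdim M. smooth_on M U (\<lambda>p. \<phi> p i)))"

text \<open>The last condition says that the coordinate functions of each chart are smooth in every
  other chart, i.e. that the transition maps are smooth.\<close>

definition smooth_functions :: "'m manifold \<Rightarrow> ('m \<Rightarrow> real) set"
  where "smooth_functions M = {f. smooth_on M UNIV f}"


section \<open>Vector bundles\<close>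

text \<open>The fibres are linear subspaces of an ambient real vector space \<open>'e\<close> which carries no further
  structure. A local trivialization \<open>(U, \<theta>)\<close> consists of linear isomorphisms \<open>\<theta> p\<close> from the
  fibre over \<open>p \<in> U\<close> onto \<open>\<real>\<^sup>r\<close>; smoothness is defined through these.\<close>

record ('m, 'e) vbundle =
  brank :: nat
  fibre :: "'m \<Rightarrow> 'e set"
  trivs :: "('m set \<times> ('m \<Rightarrow> 'e \<Rightarrow> nat \<Rightarrow> real)) set"

definition linear_betw :: "'v::real_vector set \<Rightarrow> 'w::real_vector set \<Rightarrow> ('v \<Rightarrow> 'w) \<Rightarrow> bool"
  where "linear_betw V W f \<longleftrightarrow>
    (\<forall>x\<in>V. f x \<in> W) \<and>
    (\<forall>x\<in>V. \<forall>y\<in>V. f (x + y) = f x + f y) \<and>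
    (\<forall>c. \<forall>x\<in>V. f (c *\<^sub>R x) = c *\<^sub>R f x)"

definition std_basis :: "nat \<Rightarrow> nat \<Rightarrow> real"
  where "std_basis i = (\<lambda>j. if j = i then 1 else 0)"

definition local_frame ::
    "('m, 'e) vbundle \<Rightarrow> ('m \<Rightarrow> 'e \<Rightarrow> nat \<Rightarrow> real) \<Rightarrow> nat \<Rightarrow> 'm \<Rightarrow> 'e"
  where "local_frame E \<theta> i p = inv_into (fibre E p) (\<theta> p) (std_basis i)"

definition vector_bundle ::
    "'m::{t2_space, second_countable_topology} manifold \<Rightarrow> ('m, 'e::real_vector) vbundle \<Rightarrow> bool"
  where "vector_bundle M E \<longleftrightarrow>
    (\<forall>p. subspace (fibre E p)) \<and>
    (\<Union>(U, \<theta>) \<in> trivs E. U) = UNIV \<and>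
    (\<forall>(U, \<theta>) \<in> trivs E. open U \<and>
       (\<forall>p\<in>U. bij_betw (\<theta> p) (fibre E p) (topspace (Euclidean_space (brank E))) \<and>
               linear_betw (fibre E p) UNIV (\<theta> p))) \<and>
    (\<forall>(U, \<theta>) \<in> trivs E. \<forall>(V, \<eta>) \<in> trivs E. \<forall>i < brank E. \<forall>j < brank E.
       smooth_on M (U \<inter> V) (\<lambda>p. \<eta> p (local_frame E \<theta> i p) j))"

definition sections :: "'m manifold \<Rightarrow> ('m, 'e) vbundle \<Rightarrow> ('m \<Rightarrow> 'e) set"
  where "sections M E =
    {s. (\<forall>p. s p \<in> fibre E p) \<and>
        (\<forall>(U, \<theta>) \<in> trivs E. \<forall>i < brank E. smooth_on M U (\<lambda>p. \<theta> p (s p) i))}"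

text \<open>Smooth bundle maps over the identity. The value \<open>0\<close> off the fibres makes equality of
  functions agree with equality of bundle maps.\<close>

definition bundle_map ::
    "'m manifold \<Rightarrow> ('m, 'e::real_vector) vbundle \<Rightarrow> ('m, 'f::real_vector) vbundle \<Rightarrow>
     ('m \<Rightarrow> 'e \<Rightarrow> 'f) \<Rightarrow> bool"
  where "bundle_map M E F \<Phi> \<longleftrightarrow>
    (\<forall>p. linear_betw (fibre E p) (fibre F p) (\<Phi> p)) \<and>
    (\<forall>p e. e \<notin> fibre E p \<longrightarrow> \<Phi> p e = 0) \<and>
    (\<forall>(U, \<theta>) \<in> trivs E. \<forall>(V, \<eta>) \<in> trivs F. \<forall>i < brank E. \<forall>j < brank F.
       smooth_on M (U \<inter> V) (\<lambda>p. \<eta> p (\<Phi> p (local_frame E \<theta> i p)) j))"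

definition app :: "('m \<Rightarrow> 'e \<Rightarrow> 'f) \<Rightarrow> ('m \<Rightarrow> 'e) \<Rightarrow> 'm \<Rightarrow> 'f"
  where "app \<Phi> u = (\<lambda>p. \<Phi> p (u p))"

definition fmult :: "('m \<Rightarrow> real) \<Rightarrow> ('m \<Rightarrow> 'e::real_vector) \<Rightarrow> 'm \<Rightarrow> 'e"
  where "fmult f u = (\<lambda>p. f p *\<^sub>R u p)"

text \<open>Tangent vectors at \<open>p\<close> are the derivations of \<open>C\<^sup>\<infinity>(M)\<close> at \<open>p\<close> (extended by \<open>0\<close> to
  non-smooth functions). A chart trivializes the tangent bundle by sending
  \<open>v = \<Sum>\<^sub>i c\<^sub>i \<partial>/\<partial>x\<^sup>i|\<^sub>p\<close> to its coefficients \<open>c\<close>.\<close>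

definition tangent_space :: "'m manifold \<Rightarrow> 'm \<Rightarrow> (('m \<Rightarrow> real) \<Rightarrow> real) set"
  where "tangent_space M p =
    {v. (\<forall>f \<in> smooth_functions M. \<forall>g \<in> smooth_functions M.
           v (f + g) = v f + v g \<and> v (f * g) = f p * v g + g p * v f) \<and>
        (\<forall>c. \<forall>f \<in> smooth_functions M. v (c *\<^sub>R f) = c * v f) \<and>
        (\<forall>f. f \<notin> smooth_functions M \<longrightarrow> v f = 0)}"

definition tangent_coords ::
    "'m manifold \<Rightarrow> 'm set \<Rightarrow> ('m \<Rightarrow> nat \<Rightarrow> real) \<Rightarrow> 'm \<Rightarrow> (('m \<Rightarrow> real) \<Rightarrow> real) \<Rightarrow> nat \<Rightarrow> real"
  where "tangent_coords M U \<phi> p v =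
    (THE c. c \<in> topspace (Euclidean_space (mdim M)) \<and>
       (\<forall>f \<in> smooth_functions M.
          v f = (\<Sum>i < mdim M. c i * partial_deriv i (f \<circ> inv_into U \<phi>) (\<phi> p))))"

definition tangent_bundle :: "'m manifold \<Rightarrow> ('m, ('m \<Rightarrow> real) \<Rightarrow> real) vbundle"
  where "tangent_bundle M =
    \<lparr>brank = mdim M,
     fibre = tangent_space M,
     trivs = (\<lambda>(U, \<phi>). (U, tangent_coords M U \<phi>)) ` atlas M\<rparr>"

definition deriv_along :: "('m \<Rightarrow> (('m \<Rightarrow> real) \<Rightarrow> real)) \<Rightarrow> ('m \<Rightarrow> real) \<Rightarrow> 'm \<Rightarrow> real"
  where "deriv_along X f = (\<lambda>p. X p f)"


section \<open>Lie algebroids, representations, relative Rota--Baxter operators\<close>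

text \<open>The data of a LieRep pair over \<open>base\<close>: the Lie algebroid \<open>(alg, bracket, anchor)\<close> and the
  representation \<open>rho\<close> on the bundle \<open>rep\<close>. The maps \<open>bracket\<close> and \<open>rho\<close> are only meaningful
  on smooth sections.\<close>

record ('m, 'a, 'e) lierep =
  base :: "'m manifold"
  alg :: "('m, 'a) vbundle"
  bracket :: "('m \<Rightarrow> 'a) \<Rightarrow> ('m \<Rightarrow> 'a) \<Rightarrow> 'm \<Rightarrow> 'a"
  anchor :: "'m \<Rightarrow> 'a \<Rightarrow> ('m \<Rightarrow> real) \<Rightarrow> real"
  rep :: "('m, 'e) vbundle"
  rho :: "('m \<Rightarrow> 'a) \<Rightarrow> ('m \<Rightarrow> 'e) \<Rightarrow> 'm \<Rightarrow> 'e"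

abbreviation alg_sections :: "('m, 'a, 'e) lierep \<Rightarrow> ('m \<Rightarrow> 'a) set"
  where "alg_sections L \<equiv> sections (base L) (alg L)"

abbreviation rep_sections :: "('m, 'a, 'e) lierep \<Rightarrow> ('m \<Rightarrow> 'e) set"
  where "rep_sections L \<equiv> sections (base L) (rep L)"

definition lie_algebroid ::
    "('m::{t2_space, second_countable_topology}, 'a::real_vector, 'e) lierep \<Rightarrow> bool"
  where "lie_algebroid L \<longleftrightarrow>
    vector_bundle (base L) (alg L) \<and>
    bundle_map (base L) (alg L) (tangent_bundle (base L)) (anchor L) \<and>
    (\<forall>x \<in> alg_sections L. linear_betw (alg_sections L) (alg_sections L) (bracket L x)) \<and>
    (\<forall>y \<in> alg_sections L. linear_betw (alg_sections L) (alg_sections L) (\<lambda>x. bracket L x y)) \<and>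
    (\<forall>x \<in> alg_sections L. bracket L x x = 0) \<and>
    (\<forall>x \<in> alg_sections L. \<forall>y \<in> alg_sections L. \<forall>z \<in> alg_sections L.
       bracket L x (bracket L y z) + bracket L y (bracket L z x) + bracket L z (bracket L x y) = 0) \<and>
    (\<forall>x \<in> alg_sections L. \<forall>y \<in> alg_sections L. \<forall>f \<in> smooth_functions (base L).
       bracket L x (fmult f y) =
         fmult f (bracket L x y) + fmult (deriv_along (app (anchor L) x) f) y)"

definition representation ::
    "('m::{t2_space, second_countable_topology}, 'a::real_vector, 'e::real_vector) lierep \<Rightarrow> bool"
  where "representation L \<longleftrightarrow>
    vector_bundle (base L) (rep L) \<and>
    (\<forall>x \<in> alg_sections L. linear_betw (rep_sections L) (rep_sections L) (rho L x)) \<and>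
    (\<forall>x \<in> alg_sections L. \<forall>y \<in> alg_sections L. \<forall>u \<in> rep_sections L.
       rho L (x + y) u = rho L x u + rho L y u) \<and>
    (\<forall>x \<in> alg_sections L. \<forall>u \<in> rep_sections L. \<forall>f \<in> smooth_functions (base L).
       rho L (fmult f x) u = fmult f (rho L x u) \<and>
       rho L x (fmult f u) =
         fmult f (rho L x u) + fmult (deriv_along (app (anchor L) x) f) u) \<and>
    (\<forall>x \<in> alg_sections L. \<forall>y \<in> alg_sections L. \<forall>u \<in> rep_sections L.
       rho L (bracket L x y) u = rho L x (rho L y u) - rho L y (rho L x u))"

definition lie_rep_pair ::
    "('m::{t2_space, second_countable_topology}, 'a::real_vector, 'e::real_vector) lierep \<Rightarrow> bool"
  where "lie_rep_pair L \<longleftrightarrow>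
    smooth_manifold (base L) \<and> lie_algebroid L \<and> representation L"

definition relative_rota_baxter ::
    "('m, 'a::real_vector, 'e::real_vector) lierep \<Rightarrow> ('m \<Rightarrow> 'e \<Rightarrow> 'a) \<Rightarrow> bool"
  where "relative_rota_baxter L T \<longleftrightarrow>
    bundle_map (base L) (rep L) (alg L) T \<and>
    (\<forall>u \<in> rep_sections L. \<forall>v \<in> rep_sections L.
       bracket L (app T u) (app T v) = app T (rho L (app T u) v - rho L (app T v) u))"


section \<open>Cochains, the graded Lie bracket, cohomology\<close>

text \<open>\<open>\<Gamma>(Hom(\<Lambda>\<^sup>k E, A))\<close>: families \<open>h p\<close> of alternating \<open>k\<close>-linear maps from the fibres of \<open>E\<close> to
  the fibres of \<open>A\<close>, with smooth components in local frames. Here \<open>h p\<close> is applied to lists of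
  length \<open>k\<close>.\<close>

definition alternating_multilinear ::
    "nat \<Rightarrow> 'e::real_vector set \<Rightarrow> 'a::real_vector set \<Rightarrow> ('e list \<Rightarrow> 'a) \<Rightarrow> bool"
  where "alternating_multilinear k V W h \<longleftrightarrow>
    (\<forall>es. length es = k \<and> set es \<subseteq> V \<longrightarrow>
       h es \<in> W \<and>
       (\<forall>i<k. linear_betw V W (\<lambda>e. h (es[i := e]))) \<and>
       (\<forall>i<k. \<forall>j<k. i \<noteq> j \<and> es ! i = es ! j \<longrightarrow> h es = 0))"

definition hom_sections ::
    "'m manifold \<Rightarrow> nat \<Rightarrow> ('m, 'e::real_vector) vbundle \<Rightarrow> ('m, 'a::real_vector) vbundle \<Rightarrow>
     ('m \<Rightarrow> 'e list \<Rightarrow> 'a) set"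
  where "hom_sections M k E A =
    {h. (\<forall>p. alternating_multilinear k (fibre E p) (fibre A p) (h p)) \<and>
        (\<forall>(U, \<theta>) \<in> trivs E. \<forall>(V, \<eta>) \<in> trivs A.
           \<forall>is. length is = k \<and> set is \<subseteq> {..<brank E} \<longrightarrow> (\<forall>j < brank A.
             smooth_on M (U \<inter> V) (\<lambda>p. \<eta> p (h p (map (\<lambda>i. local_frame E \<theta> i p) is)) j)))}"

text \<open>A section \<open>h\<close> of \<open>Hom(\<Lambda>\<^sup>k E, A)\<close> is identified with the induced operator
  \<open>(u\<^sub>1, \<dots>, u\<^sub>k) \<mapsto> (p \<mapsto> h p [u\<^sub>1 p, \<dots>, u\<^sub>k p])\<close> on smooth sections of \<open>E\<close>, set to \<open>0\<close> on all other
  lists. This is the form in which cochains enter the bracket, and it is faithful because every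
  vector in a fibre is the value of a global smooth section.\<close>

definition induced ::
    "('m, 'a::real_vector, 'e) lierep \<Rightarrow> nat \<Rightarrow> ('m \<Rightarrow> 'e list \<Rightarrow> 'a) \<Rightarrow> ('m \<Rightarrow> 'e) list \<Rightarrow> 'm \<Rightarrow> 'a"
  where "induced L k h us =
    (if length us = k \<and> set us \<subseteq> rep_sections L then (\<lambda>p. h p (map (\<lambda>u. u p) us)) else 0)"

definition cochains ::
    "('m, 'a::real_vector, 'e::real_vector) lierep \<Rightarrow> nat \<Rightarrow> (('m \<Rightarrow> 'e) list \<Rightarrow> 'm \<Rightarrow> 'a) set"
  where "cochains L k = induced L k ` hom_sections (base L) k (rep L) (alg L)"

text \<open>The identifications of sections of \<open>A\<close> with 0-cochains and of bundle maps \<open>E \<rightarrow> A\<close> with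
  1-cochains.\<close>

definition cochain0 ::
    "('m, 'a::real_vector, 'e) lierep \<Rightarrow> ('m \<Rightarrow> 'a) \<Rightarrow> ('m \<Rightarrow> 'e) list \<Rightarrow> 'm \<Rightarrow> 'a"
  where "cochain0 L x = induced L 0 (\<lambda>p es. x p)"

definition cochain1 ::
    "('m, 'a::real_vector, 'e) lierep \<Rightarrow> ('m \<Rightarrow> 'e \<Rightarrow> 'a) \<Rightarrow> ('m \<Rightarrow> 'e) list \<Rightarrow> 'm \<Rightarrow> 'a"
  where "cochain1 L T = induced L 1 (\<lambda>p es. T p (hd es))"

text \<open>\<open>(k\<^sub>1, \<dots>, k\<^sub>r)\<close>-unshuffles, as permutations of \<open>{0, \<dots>, k\<^sub>1 + \<dots> + k\<^sub>r - 1}\<close>.\<close>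

definition unshuffles :: "nat list \<Rightarrow> (nat \<Rightarrow> nat) set"
  where "unshuffles ks =
    {\<sigma>. \<sigma> permutes {..<sum_list ks} \<and>
        (\<forall>j < length ks.
           strict_mono_on {sum_list (take j ks)..<sum_list (take (Suc j) ks)} \<sigma>)}"

text \<open>\<open>picks us \<sigma> i j\<close> is \<open>u\<^bsub>\<sigma>(i)\<^esub>, \<dots>, u\<^bsub>\<sigma>(j-1)\<^esub>\<close>, arguments being counted from \<open>0\<close>.\<close>

definition picks :: "'u list \<Rightarrow> (nat \<Rightarrow> nat) \<Rightarrow> nat \<Rightarrow> nat \<Rightarrow> 'u list"
  where "picks us \<sigma> i j = map (\<lambda>l. us ! \<sigma> l) [i..<j]"

abbreviation rsign :: "(nat \<Rightarrow> nat) \<Rightarrow> real"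
  where "rsign \<sigma> \<equiv> real_of_int (sign \<sigma>)"

text \<open>The bracket \<open>\<lbrakk>P, Q\<rbrakk>\<close> for \<open>P\<close> of degree \<open>n\<close> and \<open>Q\<close> of degree \<open>m\<close>.\<close>

definition gla_bracket ::
    "('m, 'a::real_vector, 'e) lierep \<Rightarrow> nat \<Rightarrow> nat \<Rightarrow>
     (('m \<Rightarrow> 'e) list \<Rightarrow> 'm \<Rightarrow> 'a) \<Rightarrow> (('m \<Rightarrow> 'e) list \<Rightarrow> 'm \<Rightarrow> 'a) \<Rightarrow> ('m \<Rightarrow> 'e) list \<Rightarrow> 'm \<Rightarrow> 'a"
  where "gla_bracket L n m P Q us =
    (if length us = m + n \<and> set us \<subseteq> rep_sections L then
       (if n = 0 then 0 else
          \<Sum>\<sigma> \<in> unshuffles [m, 1, n - 1]. rsign \<sigma> *\<^sub>R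
            P (rho L (Q (picks us \<sigma> 0 m)) (us ! \<sigma> m) # picks us \<sigma> (m + 1) (m + n)))
       - (-1) ^ (m * n) *\<^sub>R
         (if m = 0 then 0 else
            \<Sum>\<sigma> \<in> unshuffles [n, 1, m - 1]. rsign \<sigma> *\<^sub>R
              Q (rho L (P (picks us \<sigma> 0 n)) (us ! \<sigma> n) # picks us \<sigma> (n + 1) (m + n)))
       + (-1) ^ (m * n) *\<^sub>R
         (\<Sum>\<sigma> \<in> unshuffles [n, m]. rsign \<sigma> *\<^sub>R
            bracket L (P (picks us \<sigma> 0 n)) (Q (picks us \<sigma> n (m + n))))
     else 0)"

definition d_T ::
    "('m, 'a::real_vector, 'e) lierep \<Rightarrow> ('m \<Rightarrow> 'e \<Rightarrow> 'a) \<Rightarrow> nat \<Rightarrow>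
     (('m \<Rightarrow> 'e) list \<Rightarrow> 'm \<Rightarrow> 'a) \<Rightarrow> ('m \<Rightarrow> 'e) list \<Rightarrow> 'm \<Rightarrow> 'a"
  where "d_T L T k P = (-1) ^ k *\<^sub>R gla_bracket L 1 k (cochain1 L T) P"

definition cocycles ::
    "('m, 'a::real_vector, 'e::real_vector) lierep \<Rightarrow> ('m \<Rightarrow> 'e \<Rightarrow> 'a) \<Rightarrow> nat \<Rightarrow>
     (('m \<Rightarrow> 'e) list \<Rightarrow> 'm \<Rightarrow> 'a) set"
  where "cocycles L T k = {P \<in> cochains L k. d_T L T k P = 0}"

definition coboundaries ::
    "('m, 'a::real_vector, 'e::real_vector) lierep \<Rightarrow> ('m \<Rightarrow> 'e \<Rightarrow> 'a) \<Rightarrow> nat \<Rightarrow>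
     (('m \<Rightarrow> 'e) list \<Rightarrow> 'm \<Rightarrow> 'a) set"
  where "coboundaries L T k = (case k of 0 \<Rightarrow> {0} | Suc j \<Rightarrow> d_T L T j ` cochains L j)"

definition cohomologous ::
    "('m, 'a::real_vector, 'e::real_vector) lierep \<Rightarrow> ('m \<Rightarrow> 'e \<Rightarrow> 'a) \<Rightarrow> nat \<Rightarrow>
     ((('m \<Rightarrow> 'e) list \<Rightarrow> 'm \<Rightarrow> 'a) \<times> (('m \<Rightarrow> 'e) list \<Rightarrow> 'm \<Rightarrow> 'a)) set"
  where "cohomologous L T k =
    {(P, Q). P \<in> cocycles L T k \<and> Q \<in> cocycles L T k \<and> P - Q \<in> coboundaries L T k}"

definition cohomology ::
    "('m, 'a::real_vector, 'e::real_vector) lierep \<Rightarrow> ('m \<Rightarrow> 'e \<Rightarrow> 'a) \<Rightarrow> nat \<Rightarrow>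
     (('m \<Rightarrow> 'e) list \<Rightarrow> 'm \<Rightarrow> 'a) set set"
  where "cohomology L T k = cocycles L T k // cohomologous L T k"


section \<open>Deformations\<close>

text \<open>A formal power series in \<open>t\<close> is its coefficient sequence; \<open>cauchy B\<close> is the
  \<open>\<real>[[t]]\<close>-bilinear extension of \<open>B\<close>.\<close>

definition cauchy ::
    "('x \<Rightarrow> 'y \<Rightarrow> 'z::comm_monoid_add) \<Rightarrow> (nat \<Rightarrow> 'x) \<Rightarrow> (nat \<Rightarrow> 'y) \<Rightarrow> nat \<Rightarrow> 'z"
  where "cauchy B X Y = (\<lambda>k. \<Sum>i\<le>k. B (X i) (Y (k - i)))"

definition deformations ::
    "('m, 'a::real_vector, 'e::real_vector) lierep \<Rightarrow> ('m \<Rightarrow> 'e \<Rightarrow> 'a) \<Rightarrow> nat \<Rightarrow>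
     (nat \<Rightarrow> 'm \<Rightarrow> 'e \<Rightarrow> 'a) set"
  where "deformations L T n =
    {D. (\<forall>i. bundle_map (base L) (rep L) (alg L) (D i)) \<and> D 0 = T \<and> (\<forall>i>n. D i = 0) \<and>
        (\<forall>u v. range u \<subseteq> rep_sections L \<and> range v \<subseteq> rep_sections L \<longrightarrow>
           (\<forall>k\<le>n.
              cauchy (bracket L) (cauchy app D u) (cauchy app D v) k =
              cauchy app D
                (cauchy (rho L) (cauchy app D u) v - cauchy (rho L) (cauchy app D v) u) k))}"

definition infinitesimal_deformations ::
    "('m, 'a::real_vector, 'e::real_vector) lierep \<Rightarrow> ('m \<Rightarrow> 'e \<Rightarrow> 'a) \<Rightarrow>
     (nat \<Rightarrow> 'm \<Rightarrow> 'e \<Rightarrow> 'a) set"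
  where "infinitesimal_deformations L T = deformations L T 1"

text \<open>\<open>ad\<^bsub>X\<^esub>\<close> on series of 1-cochains, for a series \<open>X\<close> of sections of \<open>A\<close>. If \<open>X 0 = 0\<close> then the
  terms with \<open>k > l\<close> do not contribute to the coefficient of \<open>t\<^sup>l\<close> in the exponential series.\<close>

definition ad_series ::
    "('m, 'a::real_vector, 'e) lierep \<Rightarrow> (nat \<Rightarrow> 'm \<Rightarrow> 'a) \<Rightarrow>
     (nat \<Rightarrow> ('m \<Rightarrow> 'e) list \<Rightarrow> 'm \<Rightarrow> 'a) \<Rightarrow> nat \<Rightarrow> ('m \<Rightarrow> 'e) list \<Rightarrow> 'm \<Rightarrow> 'a"
  where "ad_series L X = cauchy (gla_bracket L 0 1) (\<lambda>i. cochain0 L (X i))"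

definition exp_ad ::
    "('m, 'a::real_vector, 'e) lierep \<Rightarrow> (nat \<Rightarrow> 'm \<Rightarrow> 'a) \<Rightarrow>
     (nat \<Rightarrow> ('m \<Rightarrow> 'e) list \<Rightarrow> 'm \<Rightarrow> 'a) \<Rightarrow> nat \<Rightarrow> ('m \<Rightarrow> 'e) list \<Rightarrow> 'm \<Rightarrow> 'a"
  where "exp_ad L X P = (\<lambda>l. \<Sum>k\<le>l. (1 / fact k) *\<^sub>R (ad_series L X ^^ k) P l)"

definition deformation_equiv ::
    "('m, 'a::real_vector, 'e::real_vector) lierep \<Rightarrow> ('m \<Rightarrow> 'e \<Rightarrow> 'a) \<Rightarrow> nat \<Rightarrow>
     ((nat \<Rightarrow> 'm \<Rightarrow> 'e \<Rightarrow> 'a) \<times> (nat \<Rightarrow> 'm \<Rightarrow> 'e \<Rightarrow> 'a)) set"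
  where "deformation_equiv L T n =
    {(D, D'). D \<in> deformations L T n \<and> D' \<in> deformations L T n \<and>
       (\<exists>X. X 0 = 0 \<and> range X \<subseteq> alg_sections L \<and>
          (\<forall>l\<le>n. exp_ad L X (\<lambda>i. cochain1 L (D i)) l = cochain1 L (D' l)))}"

end

theory Submission
  imports Defs
begin

text \<open>Modulo \<open>t\<^sup>2\<close>, the relative Rota--Baxter identity for \<open>T + t D\<close> is that of \<open>T\<close> together with a
  linear equation for \<open>D\<close>, and the latter says exactly that \<open>D\<close> is a 1-cocycle; so \<open>T + t D \<mapsto> D\<close>
  maps the infinitesimal deformations onto the 1-cocycles. Modulo \<open>t\<^sup>2\<close>, \<open>exp(ad\<^bsub>tx\<^esub>)\<close> changes
  \<open>D\<close> by \<open>\<lbrakk>x, T\<rbrakk> = - d\<^sub>T x\<close>, so equivalence of deformations corresponds to being cohomologous.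
  The analytic input is that bundle maps send smooth sections to smooth sections and that a
  function is smooth if it is so locally.\<close>

section \<open>Smooth functions\<close>

lemma openin_Euclidean_space_iff:
  "openin (Euclidean_space n) S \<longleftrightarrow> (\<exists>G. open G \<and> S = G \<inter> topspace (Euclidean_space n))"
proof -
  have "openin (powertop_real UNIV) G \<longleftrightarrow> open G" for G :: "(nat \<Rightarrow> real) set"
    by (metis euclidean_product_topology open_openin)
  then show ?thesis
    by (auto simp: openin_subtopology Euclidean_space_def)
qed

text \<open>An ambient open set contains the coordinate line near \<open>x\<close>, and moving a
  coordinate of index below \<open>n\<close> does not leave R^n. Hence partial derivatives at points
  of \<open>S\<close> depend on values in \<open>S\<close> alone.\<close>

lemma eventually_coordinate_in_open:
  assumes "openin (Euclidean_space n) S" "x \<in> S" "i < n"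
  shows "\<forall>\<^sub>F t in nhds (x i). x(i := t) \<in> S"
proof -
  obtain G where G: "open G" "S = G \<inter> topspace (Euclidean_space n)"
    using assms(1) openin_Euclidean_space_iff by blast
  have "continuous_on UNIV (\<lambda>t. x(i := t))"
  proof (intro continuous_on_coordinatewise_then_product)
    show "continuous_on UNIV (\<lambda>t. (x(i := t)) j)" for j
      by (cases "j = i") (auto simp: fun_upd_def intro: continuous_on_id)
  qed
  then have "open ((\<lambda>t. x(i := t)) -` G)"
    using G(1) by (simp add: open_vimage)
  then have "\<forall>\<^sub>F t in nhds (x i). t \<in> (\<lambda>t. x(i := t)) -` G"
    using assms(2) G(2) by (intro eventually_nhds_in_open) auto
  then have "\<forall>\<^sub>F t in nhds (x i). x(i := t) \<in> G"
    by simp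
  then show ?thesis
    by eventually_elim (use assms G(2) in \<open>auto simp: topspace_Euclidean_space\<close>)
qed

lemma Ck_on_continuous: "Ck_on n k S f \<Longrightarrow> continuous_on S f"
  by (cases k) auto

lemma Ck_on_Suc_imp: "Ck_on n (Suc k) S f \<Longrightarrow> Ck_on n k S f"
proof (induction k arbitrary: f)
  case (Suc k)
  have f: "continuous_on S f"
    "\<And>i. i < n \<Longrightarrow> (\<forall>x\<in>S. \<exists>d. ((\<lambda>t. f (x(i := t))) has_real_derivative d) (at (x i))) \<and>
        Ck_on n (Suc k) S (partial_deriv i f)"
    using Suc.prems unfolding Ck_on.simps(2)[of n "Suc k"] by blast+
  show ?case
    unfolding Ck_on.simps(2)[of n k] using f Suc.IH by blast
qed simp

lemma Ck_on_subset: "Ck_on n k S f \<Longrightarrow> S' \<subseteq> S \<Longrightarrow> Ck_on n k S' f"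
  by (induction k arbitrary: f) (auto intro: continuous_on_subset)

lemma has_partial_deriv_cong:
  assumes "openin (Euclidean_space n) S" "x \<in> S" "i < n" "\<And>y. y \<in> S \<Longrightarrow> f y = g y"
  shows "((\<lambda>t. f (x(i := t))) has_real_derivative d) (at (x i)) \<longleftrightarrow>
      ((\<lambda>t. g (x(i := t))) has_real_derivative d) (at (x i))"
    and "partial_deriv i f x = partial_deriv i g x"
proof -
  have ev: "\<forall>\<^sub>F t in nhds (x i). f (x(i := t)) = g (x(i := t))"
    using eventually_coordinate_in_open[OF assms(1-3)] by eventually_elim (use assms(4) in auto)
  show "((\<lambda>t. f (x(i := t))) has_real_derivative d) (at (x i)) \<longleftrightarrow>
      ((\<lambda>t. g (x(i := t))) has_real_derivative d) (at (x i))"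
    by (intro has_field_derivative_cong_ev) (use ev in auto)
  show "partial_deriv i f x = partial_deriv i g x"
    unfolding partial_deriv_def by (intro deriv_cong_ev) (use ev in auto)
qed

text \<open>Functions agreeing on a relatively open set have partial derivatives agreeing there, so
  the induction ranges over all pairs \<open>f\<close>, \<open>g\<close>. This permits changing a
  function outside chart images, where \<open>inv_into\<close> is not under control.\<close>

lemma Ck_on_cong:
  assumes "openin (Euclidean_space n) S" "\<And>y. y \<in> S \<Longrightarrow> f y = g y" "Ck_on n k S f"
  shows "Ck_on n k S g"
  using assms(2,3)
proof (induction k arbitrary: f g)
  case 0
  then show ?case by (metis Ck_on.simps(1) continuous_on_cong)
next
  case (Suc k)
  have "Ck_on n k S (partial_deriv i g)" if "i < n" for i
  proof (rule Suc.IH)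
    show "partial_deriv i f x = partial_deriv i g x" if "x \<in> S" for x
      using has_partial_deriv_cong(2)[OF assms(1) that \<open>i < n\<close> Suc.prems(1)] .
    show "Ck_on n k S (partial_deriv i f)"
      using Suc.prems(2) \<open>i < n\<close> by simp
  qed
  moreover have "\<exists>d. ((\<lambda>t. g (x(i := t))) has_real_derivative d) (at (x i))"
    if "i < n" "x \<in> S" for i x
  proof -
    obtain d where "((\<lambda>t. f (x(i := t))) has_real_derivative d) (at (x i))"
      using Suc.prems(2) \<open>i < n\<close> \<open>x \<in> S\<close> by auto
    then show ?thesis
      using has_partial_deriv_cong(1)[where f = f and g = g, OF assms(1) that(2,1) Suc.prems(1)] by blast
  qed
  moreover have "continuous_on S g"
    using Suc.prems by (metis Ck_on_continuous continuous_on_cong)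
  ultimately show ?case by auto
qed

lemma Ck_on_const: "Ck_on n k S (\<lambda>_. c)"
proof (induction k arbitrary: c)
  case (Suc k)
  have "partial_deriv i (\<lambda>_. c) = (\<lambda>_. 0)" for i
    by (auto simp: partial_deriv_def)
  moreover have "\<exists>d. ((\<lambda>t. c) has_real_derivative d) (at (x i))" for x :: "nat \<Rightarrow> real" and i
    using DERIV_const by blast
  ultimately show ?case
    using Suc.IH by (simp only: Ck_on.simps continuous_on_const) blast
qed simp

lemma partial_deriv_works:
  assumes "Ck_on n (Suc k) S f" "x \<in> S" "i < n"
  shows "((\<lambda>t. f (x(i := t))) has_real_derivative partial_deriv i f x) (at (x i))"
proof -
  obtain d where "((\<lambda>t. f (x(i := t))) has_real_derivative d) (at (x i))"
    using assms by auto
  then show ?thesis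
    unfolding partial_deriv_def by (simp only: DERIV_imp_deriv)
qed

lemma Ck_on_add:
  assumes S: "openin (Euclidean_space n) S" and "Ck_on n k S f" "Ck_on n k S g"
  shows "Ck_on n k S (\<lambda>x. f x + g x)"
  using assms(2,3)
proof (induction k arbitrary: f g)
  case 0
  then show ?case by (auto intro: continuous_on_add)
next
  case (Suc k)
  have D: "((\<lambda>t. f (x(i := t)) + g (x(i := t))) has_real_derivative
      partial_deriv i f x + partial_deriv i g x) (at (x i))" if "x \<in> S" "i < n" for x i
    by (intro DERIV_add partial_deriv_works[OF Suc.prems(1) that] partial_deriv_works[OF Suc.prems(2) that])
  have "Ck_on n k S (partial_deriv i (\<lambda>x. f x + g x))" if "i < n" for i
  proof (rule Ck_on_cong[OF S])
    show "Ck_on n k S (\<lambda>x. partial_deriv i f x + partial_deriv i g x)"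
      using Suc.prems that by (intro Suc.IH) auto
    show "partial_deriv i f x + partial_deriv i g x = partial_deriv i (\<lambda>x. f x + g x) x" if "x \<in> S" for x
      using DERIV_imp_deriv[OF D[OF that \<open>i < n\<close>]] by (simp only: partial_deriv_def)
  qed
  moreover have "continuous_on S (\<lambda>x. f x + g x)"
    using Suc.prems by (intro continuous_on_add) (auto dest: Ck_on_continuous)
  ultimately show ?case using D by auto
qed

lemma Ck_on_mult:
  assumes S: "openin (Euclidean_space n) S" and "Ck_on n k S f" "Ck_on n k S g"
  shows "Ck_on n k S (\<lambda>x. f x * g x)"
  using assms(2,3)
proof (induction k arbitrary: f g)
  case 0
  then show ?case by (auto intro: continuous_on_mult)
next
  case (Suc k)
  have D: "((\<lambda>t. f (x(i := t)) * g (x(i := t))) has_real_derivative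
      partial_deriv i f x * g x + partial_deriv i g x * f x) (at (x i))" if "x \<in> S" "i < n" for x i
    using DERIV_mult[OF partial_deriv_works[OF Suc.prems(1) that] partial_deriv_works[OF Suc.prems(2) that]]
    by (simp only: fun_upd_triv)
  have "Ck_on n k S (partial_deriv i (\<lambda>x. f x * g x))" if "i < n" for i
  proof (rule Ck_on_cong[OF S])
    \<comment> \<open>One factor in each summand of the product rule stays undifferentiated; the
      induction hypothesis takes it at order \<open>k\<close> only.\<close>
    have "Ck_on n k S f" "Ck_on n k S g"
      using Suc.prems by (auto simp only: Ck_on_Suc_imp)
    then show "Ck_on n k S (\<lambda>x. partial_deriv i f x * g x + partial_deriv i g x * f x)"
      using Suc.prems that by (intro Ck_on_add[OF S] Suc.IH) auto
    show "partial_deriv i f x * g x + partial_deriv i g x * f x = partial_deriv i (\<lambda>x. f x * g x) x"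
      if "x \<in> S" for x
      using DERIV_imp_deriv[OF D[OF that \<open>i < n\<close>]] by (simp only: partial_deriv_def)
  qed
  moreover have "continuous_on S (\<lambda>x. f x * g x)"
    using Suc.prems by (intro continuous_on_mult) (auto dest: Ck_on_continuous)
  ultimately show ?case using D by auto
qed

text \<open>The members of \<open>\<S>\<close> are open only relative to R^n, so continuity is
  checked at each point inside one member.\<close>

lemma continuous_on_Union_openin_Euclidean:
  assumes "\<And>S. S \<in> \<S> \<Longrightarrow> openin (Euclidean_space n) S" "\<And>S. S \<in> \<S> \<Longrightarrow> continuous_on S f"
  shows "continuous_on (\<Union>\<S>) f"
  unfolding continuous_on_eq_continuous_within
proof
  fix x assume "x \<in> \<Union>\<S>"
  then obtain S where S: "S \<in> \<S>" "x \<in> S" by blast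
  obtain G where G: "open G" "S = G \<inter> topspace (Euclidean_space n)"
    using assms(1)[OF S(1)] openin_Euclidean_space_iff by blast
  have "S' \<subseteq> topspace (Euclidean_space n)" if "S' \<in> \<S>" for S'
    using assms(1)[OF that] openin_subset by blast
  \<comment> \<open>All members lie in R^n, so the ambient open set \<open>G\<close> meets the union
    exactly in \<open>S\<close>.\<close>
  then have "at x within \<Union>\<S> = at x within S"
    using S G by (intro at_within_nhd[of x G]) auto
  then show "continuous (at x within \<Union>\<S>) f"
    using assms(2)[OF S(1)] S(2) by (simp add: continuous_on_eq_continuous_within)
qed

lemma Ck_on_Union:
  assumes "\<And>S. S \<in> \<S> \<Longrightarrow> openin (Euclidean_space n) S" "\<And>S. S \<in> \<S> \<Longrightarrow> Ck_on n k S f"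
  shows "Ck_on n k (\<Union>\<S>) f"
  using assms(2)
proof (induction k arbitrary: f)
  case 0
  then show ?case
    using continuous_on_Union_openin_Euclidean[OF assms(1)] by auto
next
  case (Suc k)
  have "continuous_on (\<Union>\<S>) f"
    using continuous_on_Union_openin_Euclidean[OF assms(1)] Suc.prems by auto
  moreover have "Ck_on n k (\<Union>\<S>) (partial_deriv i f)" if "i < n" for i
    using Suc.prems that by (intro Suc.IH) auto
  ultimately show ?case
    using Suc.prems by auto
qed

section \<open>Charts and smooth functions on a manifold\<close>

lemma openin_chart_image:
  assumes "smooth_manifold M" "(U, \<phi>) \<in> atlas M" "open W"
  shows "openin (Euclidean_space (mdim M)) (\<phi> ` (U \<inter> W))"
proof -
  have "openin (Euclidean_space (mdim M)) (\<phi> ` U)"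
    and h: "homeomorphic_map (top_of_set U) (subtopology (Euclidean_space (mdim M)) (\<phi> ` U)) \<phi>"
    using assms(1,2) by (auto simp: smooth_manifold_def)
  \<comment> \<open>A chart is a homeomorphism onto its image, hence open onto it; the image is
    itself open in R^n, so transitivity finishes.\<close>
  moreover have "openin (subtopology (Euclidean_space (mdim M)) (\<phi> ` U)) (\<phi> ` (U \<inter> W))"
    using homeomorphic_imp_open_map[OF h] assms(3) by (simp add: open_map_def openin_open_Int)
  ultimately show ?thesis
    using openin_trans_full by blast
qed

lemma smooth_onI:
  "(\<And>U \<phi> k. (U, \<phi>) \<in> atlas M \<Longrightarrow> Ck_on (mdim M) k (\<phi> ` (U \<inter> W)) (f \<circ> inv_into U \<phi>)) \<Longrightarrow> smooth_on M W f"
  by (auto simp: smooth_on_def)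

lemma smooth_onD:
  "smooth_on M W f \<Longrightarrow> (U, \<phi>) \<in> atlas M \<Longrightarrow> Ck_on (mdim M) k (\<phi> ` (U \<inter> W)) (f \<circ> inv_into U \<phi>)"
  by (auto simp: smooth_on_def)

lemma chart_inv_into:
  assumes "smooth_manifold M" "(U, \<phi>) \<in> atlas M" "p \<in> U"
  shows "inv_into U \<phi> (\<phi> p) = p"
proof -
  have "homeomorphic_map (top_of_set U) (subtopology (Euclidean_space (mdim M)) (\<phi> ` U)) \<phi>"
    using assms(1,2) by (auto simp: smooth_manifold_def)
  then have "inj_on \<phi> U"
    using homeomorphic_imp_injective_map by force
  then show ?thesis
    using assms(3) by simp
qed

text \<open>Chart images of the open set \<open>W\<close> are open and
  \<open>inv_into U \<phi>\<close> maps them back into \<open>W\<close>, so the statement in R^n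
  applies. It later replaces a coordinate function by its expression in a local frame.\<close>

lemma smooth_on_cong:
  assumes "smooth_manifold M" "open W" "\<And>p. p \<in> W \<Longrightarrow> f p = g p" "smooth_on M W f"
  shows "smooth_on M W g"
proof (rule smooth_onI)
  fix U \<phi> k assume c: "(U, \<phi>) \<in> atlas M"
  show "Ck_on (mdim M) k (\<phi> ` (U \<inter> W)) (g \<circ> inv_into U \<phi>)"
    by (rule Ck_on_cong[OF openin_chart_image[OF assms(1) c assms(2)] _ smooth_onD[OF assms(4) c]])
      (auto simp: chart_inv_into[OF assms(1) c] assms(3))
qed

lemma smooth_on_subset: "smooth_on M W f \<Longrightarrow> W' \<subseteq> W \<Longrightarrow> smooth_on M W' f"
  by (rule smooth_onI, rule Ck_on_subset[OF smooth_onD]) auto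

text \<open>Chart images commute with unions, so the locality of C^k in R^n carries over to the
  manifold.\<close>

lemma smooth_on_Union:
  assumes "smooth_manifold M" "\<And>W. W \<in> \<W> \<Longrightarrow> open W" "\<And>W. W \<in> \<W> \<Longrightarrow> smooth_on M W f"
  shows "smooth_on M (\<Union>\<W>) f"
proof (rule smooth_onI)
  fix U \<phi> k assume c: "(U, \<phi>) \<in> atlas M"
  have "Ck_on (mdim M) k (\<Union>((\<lambda>W. \<phi> ` (U \<inter> W)) ` \<W>)) (f \<circ> inv_into U \<phi>)"
    by (rule Ck_on_Union) (use assms c in \<open>auto intro: openin_chart_image smooth_onD\<close>)
  moreover have "(\<Union>W\<in>\<W>. \<phi> ` (U \<inter> W)) = \<phi> ` (U \<inter> \<Union>\<W>)"
    by blast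
  ultimately show "Ck_on (mdim M) k (\<phi> ` (U \<inter> \<Union>\<W>)) (f \<circ> inv_into U \<phi>)"
    by simp
qed

lemma smooth_on_const: "smooth_on M W (\<lambda>_. c)"
  by (rule smooth_onI) (auto simp: o_def Ck_on_const)

lemma smooth_on_add:
  assumes "smooth_manifold M" "open W" "smooth_on M W f" "smooth_on M W g"
  shows "smooth_on M W (\<lambda>p. f p + g p)"
proof (rule smooth_onI)
  fix U \<phi> k assume c: "(U, \<phi>) \<in> atlas M"
  have "Ck_on (mdim M) k (\<phi> ` (U \<inter> W)) (\<lambda>x. (f \<circ> inv_into U \<phi>) x + (g \<circ> inv_into U \<phi>) x)"
    using smooth_onD[OF assms(3) c] smooth_onD[OF assms(4) c]
    by (rule Ck_on_add[OF openin_chart_image[OF assms(1) c assms(2)]])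
  then show "Ck_on (mdim M) k (\<phi> ` (U \<inter> W)) ((\<lambda>p. f p + g p) \<circ> inv_into U \<phi>)"
    by (simp only: o_def)
qed

lemma smooth_on_mult:
  assumes "smooth_manifold M" "open W" "smooth_on M W f" "smooth_on M W g"
  shows "smooth_on M W (\<lambda>p. f p * g p)"
proof (rule smooth_onI)
  fix U \<phi> k assume c: "(U, \<phi>) \<in> atlas M"
  have "Ck_on (mdim M) k (\<phi> ` (U \<inter> W)) (\<lambda>x. (f \<circ> inv_into U \<phi>) x * (g \<circ> inv_into U \<phi>) x)"
    using smooth_onD[OF assms(3) c] smooth_onD[OF assms(4) c]
    by (rule Ck_on_mult[OF openin_chart_image[OF assms(1) c assms(2)]])
  then show "Ck_on (mdim M) k (\<phi> ` (U \<inter> W)) ((\<lambda>p. f p * g p) \<circ> inv_into U \<phi>)"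
    by (simp only: o_def)
qed

lemma smooth_on_sum:
  assumes "smooth_manifold M" "open W" "finite I" "\<And>i. i \<in> I \<Longrightarrow> smooth_on M W (f i)"
  shows "smooth_on M W (\<lambda>p. \<Sum>i\<in>I. f i p)"
  using assms(3,4) by (induction) (auto intro: smooth_on_const smooth_on_add[OF assms(1,2)])

section \<open>Bundle maps and sections\<close>

lemma sum_fun_apply: "(\<Sum>i\<in>I. f i) x = (\<Sum>i\<in>I. f i x)"
  by (induction I rule: infinite_finite_induct) auto

lemma linear_betwD:
  assumes "linear_betw V W f"
  shows "x \<in> V \<Longrightarrow> f x \<in> W" "x \<in> V \<Longrightarrow> y \<in> V \<Longrightarrow> f (x + y) = f x + f y"
    "x \<in> V \<Longrightarrow> f (c *\<^sub>R x) = c *\<^sub>R f x"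
  using assms by (auto simp: linear_betw_def)

lemma linear_betw_zero: "linear_betw V W f \<Longrightarrow> x \<in> V \<Longrightarrow> f 0 = 0"
  using linear_betwD(3)[of V W f x 0] by simp

lemma linear_betw_diff:
  assumes "linear_betw V W f" "subspace V" "x \<in> V" "y \<in> V"
  shows "f (x - y) = f x - f y"
  using linear_betwD(2)[OF assms(1), of "x - y" y] assms by (simp add: subspace_diff)

lemma linear_betw_sum:
  assumes "linear_betw V W f" "subspace V" "\<And>i. i \<in> I \<Longrightarrow> x i \<in> V"
  shows "f (\<Sum>i\<in>I. c i *\<^sub>R x i) = (\<Sum>i\<in>I. c i *\<^sub>R f (x i))"
  using assms(3)
proof (induction I rule: infinite_finite_induct)
  case (insert j I)
  have "(\<Sum>i\<in>I. c i *\<^sub>R x i) \<in> V" "c j *\<^sub>R x j \<in> V"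
    using insert.prems assms(2) by (auto intro!: subspace_sum subspace_scale)
  then show ?case
    using insert by (simp add: linear_betwD[OF assms(1)])
qed (use linear_betw_zero[OF assms(1) subspace_0[OF assms(2)]] in auto)

lemma bundle_map_smooth:
  assumes "bundle_map M E F \<Phi>" "(U, \<theta>) \<in> trivs E" "(V, \<eta>) \<in> trivs F" "i < brank E" "j < brank F"
  shows "smooth_on M (U \<inter> V) (\<lambda>p. \<eta> p (\<Phi> p (local_frame E \<theta> i p)) j)"
proof -
  have "\<forall>(U, \<theta>) \<in> trivs E. \<forall>(V, \<eta>) \<in> trivs F. \<forall>i < brank E. \<forall>j < brank F.
      smooth_on M (U \<inter> V) (\<lambda>p. \<eta> p (\<Phi> p (local_frame E \<theta> i p)) j)"
    using assms(1) unfolding bundle_map_def by blast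
  from bspec[OF bspec[OF this assms(2), simplified] assms(3)] show ?thesis
    using assms(4,5) by simp
qed

section \<open>Trivializations, local frames and bundle maps acting on sections\<close>

context
  fixes M :: "'m::{t2_space, second_countable_topology} manifold" and E :: "('m, 'e::real_vector) vbundle"
  assumes E: "vector_bundle M E"
begin

lemma subspace_fibre: "subspace (fibre E p)"
  using E by (simp add: vector_bundle_def)

lemma trivs_cover: "\<exists>U \<theta>. (U, \<theta>) \<in> trivs E \<and> p \<in> U"
proof -
  have "p \<in> (\<Union>(U, \<theta>) \<in> trivs E. U)"
    using E by (simp add: vector_bundle_def)
  then show ?thesis by blast
qed

lemma open_triv: "(U, \<theta>) \<in> trivs E \<Longrightarrow> open U"
  using E by (auto simp: vector_bundle_def)

lemma triv_props:
  assumes "(U, \<theta>) \<in> trivs E" "p \<in> U"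
  shows "bij_betw (\<theta> p) (fibre E p) (topspace (Euclidean_space (brank E)))"
    "linear_betw (fibre E p) UNIV (\<theta> p)"
  using E assms by (auto simp: vector_bundle_def)

lemma local_frame:
  assumes "(U, \<theta>) \<in> trivs E" "p \<in> U" "i < brank E"
  shows "local_frame E \<theta> i p \<in> fibre E p" "\<theta> p (local_frame E \<theta> i p) = std_basis i"
proof -
  have "std_basis i \<in> \<theta> p ` fibre E p"
    using bij_betw_imp_surj_on[OF triv_props(1)[OF assms(1,2)]] assms(3)
    by (auto simp: std_basis_def topspace_Euclidean_space)
  then show "local_frame E \<theta> i p \<in> fibre E p" "\<theta> p (local_frame E \<theta> i p) = std_basis i"
    unfolding local_frame_def by (auto intro: inv_into_into f_inv_into_f)
qed

text \<open>As \<open>\<theta> p\<close> is injective on the fibre, it suffices to compare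
  coordinate vectors, and frame vectors have the standard basis vectors as coordinates.\<close>

lemma local_frame_expansion:
  assumes t: "(U, \<theta>) \<in> trivs E" "p \<in> U" and e: "e \<in> fibre E p"
  shows "e = (\<Sum>i<brank E. \<theta> p e i *\<^sub>R local_frame E \<theta> i p)" (is "e = ?s")
proof (rule inj_onD[OF bij_betw_imp_inj_on[OF triv_props(1)[OF t]]])
  have frame: "local_frame E \<theta> i p \<in> fibre E p" if "i \<in> {..<brank E}" for i
    using local_frame[OF t] that by simp
  show "?s \<in> fibre E p"
    using frame by (intro subspace_sum[OF subspace_fibre] subspace_scale[OF subspace_fibre])
  have "\<theta> p e \<in> topspace (Euclidean_space (brank E))"
    using triv_props(1)[OF t] e by (auto simp: bij_betw_def)
  \<comment> \<open>The entries from index \<open>brank E\<close> on vanish, so the finite sum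
    recovers the whole sequence.\<close>
  then have "\<theta> p e = (\<Sum>i<brank E. \<theta> p e i *\<^sub>R std_basis i)"
    by (auto simp: fun_eq_iff sum_fun_apply std_basis_def topspace_Euclidean_space not_less
        if_distrib[of "(*) _"] cong: if_cong)
  also have "\<dots> = \<theta> p ?s"
    by (subst linear_betw_sum[OF triv_props(2)[OF t] subspace_fibre frame]) (simp_all add: local_frame(2)[OF t])
  finally show "\<theta> p e = \<theta> p ?s" .
qed (use e in auto)

text \<open>The trivialization domains of \<open>E\<close> cover the base. This passes from the
  overlaps \<open>U \<inter> V\<close>, on which bundle maps are tested, to all of
  \<open>V\<close>.\<close>

lemma smooth_on_trivs_cover:
  assumes "smooth_manifold M" "open V" "\<And>U \<theta>. (U, \<theta>) \<in> trivs E \<Longrightarrow> smooth_on M (U \<inter> V) f"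
  shows "smooth_on M V f"
proof -
  have "smooth_on M (\<Union>((\<lambda>(U, \<theta>). U \<inter> V) ` trivs E)) f"
    using assms open_triv by (intro smooth_on_Union) auto
  moreover have "\<Union>((\<lambda>(U, \<theta>). U \<inter> V) ` trivs E) = V"
    using trivs_cover by fast
  ultimately show ?thesis by simp
qed

text \<open>In local frames the coordinates of \<open>app \<Phi> u\<close> are the matrix entries of
  \<open>\<Phi>\<close> applied to the coordinates of \<open>u\<close>: finite sums of products of
  smooth functions.\<close>

lemma app_section:
  assumes M: "smooth_manifold M" and F: "vector_bundle M F"
    and \<Phi>: "bundle_map M E F \<Phi>" and u: "u \<in> sections M E"
  shows "app \<Phi> u \<in> sections M F"
proof -
  have u_fib: "u p \<in> fibre E p" for p
    using u by (simp add: sections_def)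
  have lin: "linear_betw (fibre E p) (fibre F p) (\<Phi> p)" for p
    using \<Phi> by (simp add: bundle_map_def)
  have "smooth_on M V (\<lambda>p. \<eta> p (app \<Phi> u p) j)" if V: "(V, \<eta>) \<in> trivs F" and j: "j < brank F" for V \<eta> j
  proof (rule smooth_on_trivs_cover[OF M])
    show V_open: "open V"
      using F V by (auto simp: vector_bundle_def)
    fix U \<theta> assume U: "(U, \<theta>) \<in> trivs E"
    show "smooth_on M (U \<inter> V) (\<lambda>p. \<eta> p (app \<Phi> u p) j)"
    proof (rule smooth_on_cong[OF M])
      show W: "open (U \<inter> V)"
        using U V_open open_triv by blast
      show "smooth_on M (U \<inter> V) (\<lambda>p. \<Sum>i<brank E. \<theta> p (u p) i * \<eta> p (\<Phi> p (local_frame E \<theta> i p)) j)"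
      proof (intro smooth_on_sum[OF M W] smooth_on_mult[OF M W] finite_lessThan)
        fix i assume "i \<in> {..<brank E}"
        then have i: "i < brank E" by simp
        then have "smooth_on M U (\<lambda>p. \<theta> p (u p) i)"
          using u U by (auto simp: sections_def)
        then show "smooth_on M (U \<inter> V) (\<lambda>p. \<theta> p (u p) i)"
          by (rule smooth_on_subset) auto
        show "smooth_on M (U \<inter> V) (\<lambda>p. \<eta> p (\<Phi> p (local_frame E \<theta> i p)) j)"
          by (rule bundle_map_smooth[OF \<Phi> U V i j])
      qed
      fix p assume p: "p \<in> U \<inter> V"
      have frame: "local_frame E \<theta> i p \<in> fibre E p" if "i \<in> {..<brank E}" for i
        using local_frame(1)[OF U] p that by simp
      have \<eta>: "linear_betw (fibre F p) UNIV (\<eta> p)" and sF: "subspace (fibre F p)"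
        using F V p by (auto simp: vector_bundle_def)
      \<comment> \<open>Linearity of \<open>\<Phi> p\<close>, and then of \<open>\<eta> p\<close>,
        turns the frame expansion of \<open>u p\<close> into the matrix formula.\<close>
      have "\<Phi> p (u p) = \<Phi> p (\<Sum>i<brank E. \<theta> p (u p) i *\<^sub>R local_frame E \<theta> i p)"
        using local_frame_expansion[OF U _ u_fib] p by simp
      also have "\<dots> = (\<Sum>i<brank E. \<theta> p (u p) i *\<^sub>R \<Phi> p (local_frame E \<theta> i p))"
        by (rule linear_betw_sum[OF lin subspace_fibre frame])
      finally show "(\<Sum>i<brank E. \<theta> p (u p) i * \<eta> p (\<Phi> p (local_frame E \<theta> i p)) j) = \<eta> p (app \<Phi> u p) j"
        using linear_betw_sum[OF \<eta> sF, of "{..<brank E}" "\<lambda>i. \<Phi> p (local_frame E \<theta> i p)"]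
          linear_betwD(1)[OF lin frame]
        by (simp add: app_def sum_fun_apply)
    qed
  qed
  then show ?thesis
    using linear_betwD(1)[OF lin u_fib] by (auto simp: sections_def app_def)
qed

end

section \<open>Sums of sections, the zero section and the zero bundle map\<close>

lemma smooth_on_fibre_coords:
  assumes "s \<in> sections M E" "(U, \<theta>) \<in> trivs E" "i < brank E"
  shows "smooth_on M U (\<lambda>p. \<theta> p (s p) i)"
  using assms by (auto simp: sections_def)

lemma sections_add:
  assumes M: "smooth_manifold M" and E: "vector_bundle M E"
    and u: "u \<in> sections M E" and v: "v \<in> sections M E"
  shows "u + v \<in> sections M E"
proof -
  have fib: "u p \<in> fibre E p" "v p \<in> fibre E p" for p
    using u v by (auto simp: sections_def)
  have "smooth_on M U (\<lambda>p. \<theta> p ((u + v) p) i)" if U: "(U, \<theta>) \<in> trivs E" and i: "i < brank E" for U \<theta> i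
  proof (rule smooth_on_cong[OF M open_triv[OF E U]])
    show "smooth_on M U (\<lambda>p. \<theta> p (u p) i + \<theta> p (v p) i)"
      by (intro smooth_on_add[OF M open_triv[OF E U]] smooth_on_fibre_coords[OF _ U i] u v)
    show "\<theta> p (u p) i + \<theta> p (v p) i = \<theta> p ((u + v) p) i" if "p \<in> U" for p
      using linear_betwD(2)[OF triv_props(2)[OF E U that] fib] by simp
  qed
  then show ?thesis
    using fib subspace_add[OF subspace_fibre[OF E]] by (auto simp: sections_def)
qed

lemma triv_zero:
  assumes "vector_bundle M E" "(U, \<theta>) \<in> trivs E" "p \<in> U"
  shows "\<theta> p 0 = 0"
  using linear_betw_zero[OF triv_props(2)[OF assms] subspace_0[OF subspace_fibre[OF assms(1)]]] .

lemma sections_zero: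
  assumes M: "smooth_manifold M" and E: "vector_bundle M E"
  shows "0 \<in> sections M E"
proof -
  have "smooth_on M U (\<lambda>p. \<theta> p 0 i)" if U: "(U, \<theta>) \<in> trivs E" for U \<theta> i
    by (rule smooth_on_cong[OF M open_triv[OF E U] _ smooth_on_const[of M U 0]])
      (simp add: triv_zero[OF E U])
  then show ?thesis
    using subspace_0[OF subspace_fibre[OF E]] by (auto simp: sections_def)
qed

text \<open>Trivializations send the zero vector to zero, so all local components are constant. The
  zero map supplies the coefficients of order above 1 in an infinitesimal deformation.\<close>

lemma bundle_map_zero:
  assumes M: "smooth_manifold M" and E: "vector_bundle M E" and F: "vector_bundle M F"
  shows "bundle_map M E F 0"
proof -
  have "smooth_on M (U \<inter> V) (\<lambda>p. \<eta> p 0 j)"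
    if U: "(U, \<theta>) \<in> trivs E" and V: "(V, \<eta>) \<in> trivs F" for U \<theta> V \<eta> j
    by (rule smooth_on_cong[OF M _ _ smooth_on_const[of M "U \<inter> V" 0]])
      (use open_triv[OF E U] open_triv[OF F V] triv_zero[OF F V] in auto)
  then show ?thesis
    using subspace_0[OF subspace_fibre[OF F]] unfolding bundle_map_def linear_betw_def by auto
qed

section \<open>Low degree cochains\<close>

text \<open>Monotonicity on a block with at most one element is vacuous. For cochains of degree at
  most 1 all blocks are of this kind, so the bracket sums over all permutations.\<close>

lemma unshuffles_blocks_le_1:
  assumes "\<And>k. k \<in> set ks \<Longrightarrow> k \<le> 1"
  shows "unshuffles ks = {\<sigma>. \<sigma> permutes {..<sum_list ks}}"
proof -
  have "strict_mono_on {sum_list (take j ks)..<sum_list (take (Suc j) ks)} \<sigma>"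
    if "j < length ks" for j and \<sigma> :: "nat \<Rightarrow> nat"
  proof -
    have "sum_list (take (Suc j) ks) = sum_list (take j ks) + ks ! j"
      using that by (simp add: take_Suc_conv_app_nth)
    moreover have "ks ! j \<le> 1"
      using that assms by simp
    ultimately show ?thesis
      by (auto simp: strict_mono_on_def)
  qed
  then show ?thesis
    by (auto simp: unshuffles_def)
qed

lemma unshuffles_singleton:
  "unshuffles [0, 1] = {id}" "unshuffles [1, 0] = {id}" "unshuffles [0, 1, 0] = {id}"
  by (subst unshuffles_blocks_le_1; auto simp: lessThan_Suc)+

lemma permutes_lessThan_2: "{\<sigma>. \<sigma> permutes {..<2::nat}} = {id, Transposition.transpose 0 1}"
proof -
  have "{..<2::nat} = {0, 1}" by auto
  then show ?thesis by (auto simp: permutes_doubleton_iff)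
qed

lemma unshuffles_doubleton:
  "unshuffles [1, 1] = {id, Transposition.transpose 0 1}" "unshuffles [1, 1, 0] = {id, Transposition.transpose 0 1}"
proof -
  have s: "sum_list [1, 1] = (2::nat)" "sum_list [1, 1, 0] = (2::nat)"
    by simp_all
  show "unshuffles [1, 1] = {id, Transposition.transpose 0 1}"
    by (subst unshuffles_blocks_le_1, force, simp only: s permutes_lessThan_2)
  show "unshuffles [1, 1, 0] = {id, Transposition.transpose 0 1}"
    by (subst unshuffles_blocks_le_1, force, simp only: s permutes_lessThan_2)
qed

lemma sum_id_transpose:
  "(\<Sum>\<sigma>\<in>{id, Transposition.transpose 0 (1::nat)}. f \<sigma>) = f id + f (Transposition.transpose 0 1)"
proof -
  have "id \<noteq> Transposition.transpose 0 (1::nat)"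
    by (metis id_apply transpose_apply_first zero_neq_one)
  then show ?thesis by simp
qed

section \<open>The graded bracket in degrees 0 and 1\<close>

text \<open>Each difference pairs the identity with the transposition, of sign -1. Since
  \<open>(-1) ^ (m * n)\<close> is -1 as well, the second sum enters with plus and the third with
  minus.\<close>

lemma gla_bracket_1_1:
  assumes "u \<in> rep_sections L" "v \<in> rep_sections L"
  shows "gla_bracket L 1 1 P Q [u, v] =
    P [rho L (Q [u]) v] - P [rho L (Q [v]) u] + (Q [rho L (P [u]) v] - Q [rho L (P [v]) u])
    - (bracket L (P [u]) (Q [v]) - bracket L (P [v]) (Q [u]))"
  using assms
  by (simp add: gla_bracket_def unshuffles_doubleton[simplified] sum_id_transpose[simplified] picks_def sign_id sign_swap_id)

text \<open>For \<open>n = 0\<close> the first sum would have a block of length -1 and is zero; the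
  sign \<open>(-1) ^ (m * n)\<close> is 1.\<close>

lemma gla_bracket_0_1:
  assumes "u \<in> rep_sections L"
  shows "gla_bracket L 0 1 P Q [u] = bracket L (P []) (Q [u]) - Q [rho L (P []) u]"
  using assms
  by (simp add: gla_bracket_def unshuffles_singleton[simplified] picks_def sign_id)

text \<open>Here \<open>m = 0\<close>, so the second sum is the one that drops out.\<close>

lemma gla_bracket_1_0:
  assumes "u \<in> rep_sections L"
  shows "gla_bracket L 1 0 P Q [u] = P [rho L (Q []) u] + bracket L (P [u]) (Q [])"
  using assms
  by (simp add: gla_bracket_def unshuffles_singleton[simplified] picks_def sign_id)

lemma gla_bracket_outside:
  "\<not> (length us = m + n \<and> set us \<subseteq> rep_sections L) \<Longrightarrow> gla_bracket L n m P Q us = 0"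
  unfolding gla_bracket_def by (rule if_not_P)

lemma cochain0_Nil [simp]: "cochain0 L x [] = x"
  by (simp add: cochain0_def induced_def)

lemma cochain1_single: "u \<in> rep_sections L \<Longrightarrow> cochain1 L D [u] = app D u"
  by (simp add: cochain1_def induced_def app_def)

lemma cochain1_outside: "\<not> (length us = 1 \<and> set us \<subseteq> rep_sections L) \<Longrightarrow> cochain1 L D us = 0"
  unfolding cochain1_def induced_def by (rule if_not_P)

text \<open>Degree 1 cochains and brackets are 0 by convention off one-element lists of sections, so
  comparing them reduces to a single argument.\<close>

lemma eq_on_singletonsI:
  assumes "\<And>u. u \<in> rep_sections L \<Longrightarrow> f [u] = g [u]"
    and "\<And>us. \<not> (length us = 1 \<and> set us \<subseteq> rep_sections L) \<Longrightarrow> f us = 0"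
    and "\<And>us. \<not> (length us = 1 \<and> set us \<subseteq> rep_sections L) \<Longrightarrow> g us = 0"
  shows "f = g"
proof
  fix us
  show "f us = g us"
  proof (cases "length us = 1 \<and> set us \<subseteq> rep_sections L")
    case True
    then obtain u where "us = [u]" by (auto simp: length_Suc_conv)
    then show ?thesis using True assms(1) by simp
  qed (simp add: assms(2,3))
qed

section \<open>Sections of the Hom bundles in degrees 0 and 1\<close>

lemma hom_sections_smooth:
  assumes "h \<in> hom_sections M k E A" "(U, \<theta>) \<in> trivs E" "(V, \<eta>) \<in> trivs A"
    "length is = k" "set is \<subseteq> {..<brank E}" "j < brank A"
  shows "smooth_on M (U \<inter> V) (\<lambda>p. \<eta> p (h p (map (\<lambda>i. local_frame E \<theta> i p) is)) j)"
proof -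
  have "\<forall>(U, \<theta>) \<in> trivs E. \<forall>(V, \<eta>) \<in> trivs A.
      \<forall>is. length is = k \<and> set is \<subseteq> {..<brank E} \<longrightarrow> (\<forall>j < brank A.
        smooth_on M (U \<inter> V) (\<lambda>p. \<eta> p (h p (map (\<lambda>i. local_frame E \<theta> i p) is)) j))"
    using assms(1) unfolding hom_sections_def by blast
  from bspec[OF bspec[OF this assms(2), simplified] assms(3)] show ?thesis
    using assms(4-6) by simp
qed

context
  fixes M :: "'m::{t2_space, second_countable_topology} manifold"
    and E :: "('m, 'e::real_vector) vbundle" and A :: "('m, 'a::real_vector) vbundle"
  assumes M: "smooth_manifold M" and E: "vector_bundle M E" and A: "vector_bundle M A"
begin

text \<open>The only index list is \<open>[]\<close>, but one side tests smoothness on overlaps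
  \<open>U \<inter> V\<close> and the other on \<open>V\<close>. Covering \<open>V\<close> by
  domains of \<open>E\<close> gives one direction, restriction the other.\<close>

lemma hom_sections_0_iff: "h \<in> hom_sections M 0 E A \<longleftrightarrow> (\<lambda>p. h p []) \<in> sections M A"
proof
  assume h: "h \<in> hom_sections M 0 E A"
  have "smooth_on M V (\<lambda>p. \<eta> p (h p []) j)" if "(V, \<eta>) \<in> trivs A" "j < brank A" for V \<eta> j
    using hom_sections_smooth[OF h _ that(1) _ _ that(2), of _ _ "[]"]
    by (intro smooth_on_trivs_cover[OF E M open_triv[OF A that(1)]]) auto
  then show "(\<lambda>p. h p []) \<in> sections M A"
    using h by (auto simp: sections_def hom_sections_def alternating_multilinear_def)
next
  assume h: "(\<lambda>p. h p []) \<in> sections M A"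
  have "smooth_on M (U \<inter> V) (\<lambda>p. \<eta> p (h p []) j)" if "(V, \<eta>) \<in> trivs A" "j < brank A" for U V \<eta> j
    using smooth_on_fibre_coords[OF h that] by (rule smooth_on_subset) auto
  then show "h \<in> hom_sections M 0 E A"
    using h by (auto simp: sections_def hom_sections_def alternating_multilinear_def)
qed

lemma bundle_map_imp_hom_sections_1:
  assumes D: "bundle_map M E A D"
  shows "(\<lambda>p es. D p (hd es)) \<in> hom_sections M 1 E A"
proof -
  have lin: "linear_betw (fibre E p) (fibre A p) (D p)" for p
    using D by (simp add: bundle_map_def)
  have "alternating_multilinear 1 (fibre E p) (fibre A p) (\<lambda>es. D p (hd es))" for p
    using lin[of p] linear_betwD(1)[OF lin[of p]]
    by (auto simp: alternating_multilinear_def length_Suc_conv)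
  moreover have "smooth_on M (U \<inter> V) (\<lambda>p. \<eta> p (D p (hd (map (\<lambda>i. local_frame E \<theta> i p) is))) j)"
    if "(U, \<theta>) \<in> trivs E" "(V, \<eta>) \<in> trivs A" "length is = 1" "set is \<subseteq> {..<brank E}" "j < brank A"
    for U \<theta> V \<eta> "is" j
    using bundle_map_smooth[OF D that(1,2) _ that(5)] that(3,4) by (auto simp: length_Suc_conv)
  ultimately show ?thesis
    by (auto simp: hom_sections_def)
qed

lemma hom_sections_1_imp_bundle_map:
  assumes h: "h \<in> hom_sections M 1 E A"
  shows "bundle_map M E A (\<lambda>p e. if e \<in> fibre E p then h p [e] else 0)" (is "bundle_map M E A ?D")
proof -
  have "linear_betw (fibre E p) (fibre A p) (?D p)" for p
  proof -
    have alt: "alternating_multilinear 1 (fibre E p) (fibre A p) (h p)"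
      using h by (simp add: hom_sections_def)
    \<comment> \<open>Multilinearity is phrased by updating a list of fibre vectors. The fibre
      contains 0, so \<open>[0]\<close> is such a list, and updating it yields
      \<open>[e]\<close>.\<close>
    have "linear_betw (fibre E p) (fibre A p) (\<lambda>e. h p ([0][0 := e]))"
      using alt subspace_0[OF subspace_fibre[OF E, of p]]
      unfolding alternating_multilinear_def by (elim allE[of _ "[0]"]) simp
    then show ?thesis
      using subspace_fibre[OF E, of p] by (auto simp: linear_betw_def subspace_def)
  qed
  moreover have "smooth_on M (U \<inter> V) (\<lambda>p. \<eta> p (?D p (local_frame E \<theta> i p)) j)"
    if U: "(U, \<theta>) \<in> trivs E" and V: "(V, \<eta>) \<in> trivs A" and i: "i < brank E" and j: "j < brank A"
    for U \<theta> V \<eta> i j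
  proof (rule smooth_on_cong[OF M])
    show "open (U \<inter> V)"
      using open_triv[OF E U] open_triv[OF A V] by blast
    show "smooth_on M (U \<inter> V) (\<lambda>p. \<eta> p (h p [local_frame E \<theta> i p]) j)"
      using hom_sections_smooth[OF h U V, of "[i]" j] i j by simp
    show "\<eta> p (h p [local_frame E \<theta> i p]) j = \<eta> p (?D p (local_frame E \<theta> i p)) j" if "p \<in> U \<inter> V" for p
      using local_frame(1)[OF E U _ i, of p] that by simp
  qed
  ultimately show ?thesis
    unfolding bundle_map_def by auto
qed

end

section \<open>Infinitesimal deformations and cocycles\<close>

text \<open>This is the coefficient of t in the Rota--Baxter identity for T + tD, evaluated on
  sections independent of t.\<close>

definition linear_rota_baxter_eq ::
    "('m, 'a::real_vector, 'e::real_vector) lierep \<Rightarrow> ('m \<Rightarrow> 'e \<Rightarrow> 'a) \<Rightarrow> ('m \<Rightarrow> 'e \<Rightarrow> 'a) \<Rightarrow> bool"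
  where "linear_rota_baxter_eq L T D \<longleftrightarrow>
    (\<forall>u \<in> rep_sections L. \<forall>v \<in> rep_sections L.
       bracket L (app T u) (app D v) + bracket L (app D u) (app T v) =
       app T (rho L (app D u) v - rho L (app D v) u) + app D (rho L (app T u) v - rho L (app T v) u))"

section \<open>Calculus with sections over a fixed LieRep pair\<close>

context
  fixes L :: "('m::{t2_space, second_countable_topology}, 'a::real_vector, 'e::real_vector) lierep"
    and T :: "'m \<Rightarrow> 'e \<Rightarrow> 'a"
  assumes pair: "lie_rep_pair L" and rota_baxter: "relative_rota_baxter L T"
begin

abbreviation "A_map \<equiv> bundle_map (base L) (rep L) (alg L)"

lemma base_smooth: "smooth_manifold (base L)"
  and alg_bundle: "vector_bundle (base L) (alg L)"
  and rep_bundle: "vector_bundle (base L) (rep L)"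
  and T_map: "A_map T"
  using pair rota_baxter
  by (auto simp: lie_rep_pair_def lie_algebroid_def representation_def relative_rota_baxter_def)

lemma app_A_map: "A_map D \<Longrightarrow> u \<in> rep_sections L \<Longrightarrow> app D u \<in> alg_sections L"
  by (rule app_section[OF rep_bundle base_smooth alg_bundle])

lemma rho_section: "x \<in> alg_sections L \<Longrightarrow> u \<in> rep_sections L \<Longrightarrow> rho L x u \<in> rep_sections L"
  using pair by (auto simp: lie_rep_pair_def representation_def linear_betw_def)

lemma rho_add_left:
  "x \<in> alg_sections L \<Longrightarrow> y \<in> alg_sections L \<Longrightarrow> u \<in> rep_sections L \<Longrightarrow>
    rho L (x + y) u = rho L x u + rho L y u"
  using pair by (auto simp: lie_rep_pair_def representation_def)

lemma bracket_add:
  assumes "x \<in> alg_sections L" "y \<in> alg_sections L" "z \<in> alg_sections L"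
  shows "bracket L (x + y) z = bracket L x z + bracket L y z"
    "bracket L z (x + y) = bracket L z x + bracket L z y"
  using pair assms by (auto simp: lie_rep_pair_def lie_algebroid_def linear_betw_def)

text \<open>Polarization: the alternating property is applied to \<open>x + y\<close> and
  expanded.\<close>

lemma bracket_antisym:
  assumes x: "x \<in> alg_sections L" and y: "y \<in> alg_sections L"
  shows "bracket L x y = - bracket L y x"
proof -
  have xy: "x + y \<in> alg_sections L"
    by (rule sections_add[OF base_smooth alg_bundle x y])
  have self: "bracket L z z = 0" if "z \<in> alg_sections L" for z
    using pair that by (auto simp: lie_rep_pair_def lie_algebroid_def)
  have "0 = bracket L (x + y) (x + y)"
    using self[OF xy] by simp
  also have "\<dots> = bracket L x x + bracket L x y + (bracket L y x + bracket L y y)"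
    by (simp only: bracket_add(1)[OF x y xy] bracket_add(2)[OF x y x] bracket_add(2)[OF x y y])
  finally show ?thesis
    by (simp add: self x y eq_neg_iff_add_eq_0)
qed

text \<open>Smoothness is dropped here because \<open>app D\<close> is linear on all fields, which form a subspace
  without any appeal to charts.\<close>

definition "rep_fields = {u. \<forall>p. u p \<in> fibre (rep L) p}"

lemma rep_section_field: "u \<in> rep_sections L \<Longrightarrow> u \<in> rep_fields"
  by (simp add: rep_fields_def sections_def)

lemma subspace_rep_fields: "subspace rep_fields"
  using subspace_fibre[OF rep_bundle] by (simp add: subspace_def rep_fields_def)

lemma linear_app:
  assumes "A_map D"
  shows "linear_betw rep_fields UNIV (app D)"
  using assms by (auto simp: bundle_map_def linear_betw_def rep_fields_def app_def fun_eq_iff)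

lemma app_add:
  "A_map D \<Longrightarrow> u \<in> rep_fields \<Longrightarrow> v \<in> rep_fields \<Longrightarrow> app D (u + v) = app D u + app D v"
  by (rule linear_betwD(2)[OF linear_app])

lemma app_diff:
  "A_map D \<Longrightarrow> u \<in> rep_fields \<Longrightarrow> v \<in> rep_fields \<Longrightarrow> app D (u - v) = app D u - app D v"
  by (rule linear_betw_diff[OF linear_app subspace_rep_fields])

section \<open>Linearization of the Rota--Baxter identity\<close>

lemma rota_baxter_eq:
  "u \<in> rep_sections L \<Longrightarrow> v \<in> rep_sections L \<Longrightarrow>
    bracket L (app T u) (app T v) = app T (rho L (app T u) v - rho L (app T v) u)"
  using rota_baxter by (auto simp: relative_rota_baxter_def)

text \<open>In degree 1 the differential is minus the bracket with \<open>T\<close>, and that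
  bracket on a pair is the right side minus the left side of the linearized identity.\<close>

lemma d_T_cochain1_eq_0_iff:
  assumes D: "A_map D"
  shows "d_T L T 1 (cochain1 L D) = 0 \<longleftrightarrow> linear_rota_baxter_eq L T D"
proof -
  let ?B = "gla_bracket L 1 1 (cochain1 L T) (cochain1 L D)"
  let ?lhs = "\<lambda>u v. bracket L (app T u) (app D v) + bracket L (app D u) (app T v)"
  let ?rhs = "\<lambda>u v. app T (rho L (app D u) v - rho L (app D v) u) +
      app D (rho L (app T u) v - rho L (app T v) u)"
  \<comment> \<open>Antisymmetry turns the term \<open>bracket L (app T v) (app D u)\<close> of the
    bracket formula into the second summand of \<open>?lhs\<close>.\<close>
  have B: "?B [u, v] = ?rhs u v - ?lhs u v" if u: "u \<in> rep_sections L" and v: "v \<in> rep_sections L" for u v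
    using u v
    by (simp add: gla_bracket_1_1[simplified] cochain1_single[simplified] rho_section app_A_map T_map D
        app_diff rep_section_field bracket_antisym[of "app T v" "app D u"])
  have "d_T L T 1 (cochain1 L D) = 0 \<longleftrightarrow> ?B = 0"
    by (simp add: d_T_def)
  \<comment> \<open>Off pairs of sections the bracket is 0 by convention.\<close>
  also have "\<dots> \<longleftrightarrow> (\<forall>u \<in> rep_sections L. \<forall>v \<in> rep_sections L. ?B [u, v] = 0)"
  proof
    assume R: "\<forall>u \<in> rep_sections L. \<forall>v \<in> rep_sections L. ?B [u, v] = 0"
    show "?B = 0"
    proof
      fix us
      show "?B us = 0 us"
      proof (cases "length us = 1 + 1 \<and> set us \<subseteq> rep_sections L")
        case True
        then obtain u v where "us = [u, v]" by (auto simp: length_Suc_conv)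
        then show ?thesis using True R by simp
      qed (simp add: gla_bracket_outside)
    qed
  qed simp
  finally show ?thesis
    using B by (auto simp: linear_rota_baxter_eq_def)
qed

text \<open>At order t the terms in \<open>u 1\<close> or \<open>v 1\<close> form the identity for
  \<open>T\<close> at the pairs \<open>u 0\<close>, \<open>v 1\<close> and \<open>u 1\<close>,
  \<open>v 0\<close>, and cancel. The linearized identity at \<open>u 0\<close>, \<open>v 0\<close>
  remains.\<close>

lemma deformation_eq_1_iff:
  assumes D: "A_map (D 1)" "D 0 = T"
    and u: "range u \<subseteq> rep_sections L" and v: "range v \<subseteq> rep_sections L"
  shows "cauchy (bracket L) (cauchy app D u) (cauchy app D v) 1 =
      cauchy app D (cauchy (rho L) (cauchy app D u) v - cauchy (rho L) (cauchy app D v) u) 1 \<longleftrightarrow>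
    bracket L (app T (u 0)) (app (D 1) (v 0)) + bracket L (app (D 1) (u 0)) (app T (v 0)) =
      app T (rho L (app (D 1) (u 0)) (v 0) - rho L (app (D 1) (v 0)) (u 0)) +
      app (D 1) (rho L (app T (u 0)) (v 0) - rho L (app T (v 0)) (u 0))"
proof -
  have s: "u i \<in> rep_sections L" "v i \<in> rep_sections L" for i
    using u v by auto
  have a: "app T (u i) \<in> alg_sections L" "app T (v i) \<in> alg_sections L"
    "app (D 1) (u i) \<in> alg_sections L" "app (D 1) (v i) \<in> alg_sections L" for i
    using s app_A_map T_map D by auto
  note f = rep_section_field[OF rho_section[OF a(1) s(2)]] rep_section_field[OF rho_section[OF a(2) s(1)]]
    rep_section_field[OF rho_section[OF a(3) s(2)]] rep_section_field[OF rho_section[OF a(4) s(1)]]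
  have c: "cauchy app D w 0 = app T (w 0)" "cauchy app D w 1 = app T (w 1) + app (D 1) (w 0)" for w
    using D(2) by (simp_all add: cauchy_def)
  have L: "cauchy (bracket L) (cauchy app D u) (cauchy app D v) 1 =
      bracket L (app T (u 0)) (app T (v 1)) + bracket L (app T (u 1)) (app T (v 0)) +
      (bracket L (app T (u 0)) (app (D 1) (v 0)) + bracket L (app (D 1) (u 0)) (app T (v 0)))"
    unfolding cauchy_def[of "bracket L"] using c[of u] c[of v] by (simp add: bracket_add a[simplified])
  have W0: "(cauchy (rho L) (cauchy app D u) v - cauchy (rho L) (cauchy app D v) u) 0 =
      rho L (app T (u 0)) (v 0) - rho L (app T (v 0)) (u 0)"
    by (simp add: cauchy_def[of "rho L"] c)
  \<comment> \<open>The summands are grouped so that \<open>app T\<close> of the first two groups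
    matches the first two brackets in \<open>L\<close>.\<close>
  have W1: "(cauchy (rho L) (cauchy app D u) v - cauchy (rho L) (cauchy app D v) u) 1 =
      (rho L (app T (u 0)) (v 1) - rho L (app T (v 1)) (u 0)) +
      (rho L (app T (u 1)) (v 0) - rho L (app T (v 0)) (u 1)) +
      (rho L (app (D 1) (u 0)) (v 0) - rho L (app (D 1) (v 0)) (u 0))"
    unfolding cauchy_def[of "rho L"] using c[of u] c[of v] by (simp add: rho_add_left a[simplified] s)
  have R: "cauchy app D (cauchy (rho L) (cauchy app D u) v - cauchy (rho L) (cauchy app D v) u) 1 =
      app T (rho L (app T (u 0)) (v 1) - rho L (app T (v 1)) (u 0)) +
      app T (rho L (app T (u 1)) (v 0) - rho L (app T (v 0)) (u 1)) +
      (app T (rho L (app (D 1) (u 0)) (v 0) - rho L (app (D 1) (v 0)) (u 0)) +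
      app (D 1) (rho L (app T (u 0)) (v 0) - rho L (app T (v 0)) (u 0)))"
    unfolding c(2) W0 W1
    by (simp add: app_add[OF T_map] f[simplified] subspace_add[OF subspace_rep_fields] subspace_diff[OF subspace_rep_fields])
  show ?thesis
    unfolding L R by (simp add: rota_baxter_eq s)
qed

text \<open>Order 0 of the deformation equation is the identity for \<open>T\<close> itself, which
  holds; order 1 is the linearized identity.\<close>

lemma infinitesimal_deformation_iff:
  "D \<in> infinitesimal_deformations L T \<longleftrightarrow>
    A_map (D 1) \<and> D 0 = T \<and> (\<forall>i>1. D i = 0) \<and> linear_rota_baxter_eq L T (D 1)"
proof
  assume "D \<in> infinitesimal_deformations L T"
  then have D: "A_map (D 1)" "D 0 = T" "\<forall>i>1. D i = 0"
    and eq: "\<And>u v. range u \<subseteq> rep_sections L \<Longrightarrow> range v \<subseteq> rep_sections L \<Longrightarrow>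
       cauchy (bracket L) (cauchy app D u) (cauchy app D v) 1 =
       cauchy app D (cauchy (rho L) (cauchy app D u) v - cauchy (rho L) (cauchy app D v) u) 1"
    by (auto simp: infinitesimal_deformations_def deformations_def)
  have "linear_rota_baxter_eq L T (D 1)"
    unfolding linear_rota_baxter_eq_def
  proof (intro ballI)
    fix u v assume "u \<in> rep_sections L" "v \<in> rep_sections L"
    \<comment> \<open>Only the coefficients at index 0 survive in the criterion, so any series of
      sections starting with \<open>u\<close> and \<open>v\<close> would serve.\<close>
    then have r: "range (\<lambda>_::nat. u) \<subseteq> rep_sections L" "range (\<lambda>_::nat. v) \<subseteq> rep_sections L" by auto
    show "bracket L (app T u) (app (D 1) v) + bracket L (app (D 1) u) (app T v) =
        app T (rho L (app (D 1) u) v - rho L (app (D 1) v) u) +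
        app (D 1) (rho L (app T u) v - rho L (app T v) u)"
      using deformation_eq_1_iff[OF D(1,2) r, THEN iffD1, OF eq[OF r]] .
  qed
  with D show "A_map (D 1) \<and> D 0 = T \<and> (\<forall>i>1. D i = 0) \<and> linear_rota_baxter_eq L T (D 1)"
    by blast
next
  assume R: "A_map (D 1) \<and> D 0 = T \<and> (\<forall>i>1. D i = 0) \<and> linear_rota_baxter_eq L T (D 1)"
  \<comment> \<open>Every coefficient of a deformation must be a bundle map; from index 2 on it is
    the zero map.\<close>
  then have "A_map (D i)" for i
    using T_map bundle_map_zero[OF base_smooth rep_bundle alg_bundle]
    by (cases "i = 0 \<or> i = 1") auto
  moreover have "cauchy (bracket L) (cauchy app D u) (cauchy app D v) k =
      cauchy app D (cauchy (rho L) (cauchy app D u) v - cauchy (rho L) (cauchy app D v) u) k"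
    if r: "range u \<subseteq> rep_sections L" "range v \<subseteq> rep_sections L" and k: "k \<le> 1" for u v k
  proof -
    have s: "u 0 \<in> rep_sections L" "v 0 \<in> rep_sections L"
      using r by auto
    consider "k = 0" | "k = 1" using k by linarith
    then show ?thesis
    proof cases
      case 1
      then show ?thesis
        using R rota_baxter_eq[OF s] by (simp add: cauchy_def)
    next
      case 2
      have "A_map (D 1)" "D 0 = T"
        using R by auto
      then show ?thesis
        unfolding 2 using R s by (subst deformation_eq_1_iff[OF _ _ r]) (auto simp: linear_rota_baxter_eq_def)
    qed
  qed
  ultimately show "D \<in> infinitesimal_deformations L T"
    using R by (simp add: infinitesimal_deformations_def deformations_def)
qed

section \<open>Cochains and cocycles in degrees 0 and 1\<close>

lemma cochains_0: "cochains L 0 = cochain0 L ` alg_sections L"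
proof -
  note iff = hom_sections_0_iff[OF base_smooth rep_bundle alg_bundle]
  have "induced L 0 h = cochain0 L (\<lambda>p. h p [])" for h
    by (auto simp: fun_eq_iff cochain0_def induced_def)
  then have "cochains L 0 \<subseteq> cochain0 L ` alg_sections L"
    by (auto simp: cochains_def iff)
  moreover have "cochain0 L ` alg_sections L \<subseteq> cochains L 0"
    by (auto simp: cochains_def cochain0_def iff)
  ultimately show ?thesis by blast
qed

lemma cochains_1: "cochains L 1 = cochain1 L ` {D. A_map D}"
proof
  show "cochain1 L ` {D. A_map D} \<subseteq> cochains L 1"
    using bundle_map_imp_hom_sections_1[OF base_smooth rep_bundle alg_bundle]
    by (auto simp: cochains_def cochain1_def)
  show "cochains L 1 \<subseteq> cochain1 L ` {D. A_map D}"
  proof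
    fix P assume "P \<in> cochains L 1"
    then obtain h where h: "h \<in> hom_sections (base L) 1 (rep L) (alg L)" and P: "P = induced L 1 h"
      by (auto simp: cochains_def)
    \<comment> \<open>\<open>bundle_map\<close> demands the value 0 off the fibres; sections stay in
      the fibres, so the induced cochain is still \<open>P\<close>.\<close>
    let ?D = "\<lambda>p e. if e \<in> fibre (rep L) p then h p [e] else 0"
    have "P = cochain1 L ?D"
    proof (rule eq_on_singletonsI)
      show "P [u] = cochain1 L ?D [u]" if "u \<in> rep_sections L" for u
        using that by (auto simp: P cochain1_single induced_def app_def sections_def)
    qed (auto simp: P induced_def cochain1_outside)
    then show "P \<in> cochain1 L ` {D. A_map D}"
      using hom_sections_1_imp_bundle_map[OF base_smooth rep_bundle alg_bundle h] by blast
  qed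
qed

lemma cochain1_cocycle_iff:
  "A_map D \<Longrightarrow> cochain1 L D \<in> cocycles L T 1 \<longleftrightarrow> linear_rota_baxter_eq L T D"
  using cochains_1 d_T_cochain1_eq_0_iff by (auto simp: cocycles_def)

lemma image_infinitesimal_deformations:
  "(\<lambda>D. cochain1 L (D 1)) ` infinitesimal_deformations L T = cocycles L T 1"
proof
  show "(\<lambda>D. cochain1 L (D 1)) ` infinitesimal_deformations L T \<subseteq> cocycles L T 1"
    using cochain1_cocycle_iff by (auto simp: infinitesimal_deformation_iff)
  show "cocycles L T 1 \<subseteq> (\<lambda>D. cochain1 L (D 1)) ` infinitesimal_deformations L T"
  proof
    fix P assume P: "P \<in> cocycles L T 1"
    then obtain D where D: "A_map D" "P = cochain1 L D"
      using cochains_1 by (auto simp: cocycles_def)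
    \<comment> \<open>The preimage of the cocycle is the series T + tD.\<close>
    let ?D = "\<lambda>i::nat. if i = 0 then T else if i = 1 then D else 0"
    have "?D \<in> infinitesimal_deformations L T"
      using P D cochain1_cocycle_iff by (simp add: infinitesimal_deformation_iff)
    then show "P \<in> (\<lambda>D. cochain1 L (D 1)) ` infinitesimal_deformations L T"
      using D(2) by (intro image_eqI[of _ _ ?D]) auto
  qed
qed

section \<open>Equivalence of deformations and coboundaries\<close>

text \<open>Graded antisymmetry in degrees 0 and 1, reduced to antisymmetry of the Lie bracket. It
  lets the adjoint action of \<open>x\<close> on \<open>T\<close> be read as minus a
  coboundary.\<close>

lemma gla_bracket_section:
  assumes x: "x \<in> alg_sections L" and D: "A_map D"
  shows "gla_bracket L 0 1 (cochain0 L x) (cochain1 L D) = - gla_bracket L 1 0 (cochain1 L D) (cochain0 L x)"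
proof (rule eq_on_singletonsI)
  fix u assume u: "u \<in> rep_sections L"
  show "gla_bracket L 0 1 (cochain0 L x) (cochain1 L D) [u] =
      (- gla_bracket L 1 0 (cochain1 L D) (cochain0 L x)) [u]"
    using gla_bracket_0_1[OF u] gla_bracket_1_0[OF u] bracket_antisym[OF x app_A_map[OF D u]]
    by (simp add: u cochain1_single rho_section[OF x])
qed (auto simp: gla_bracket_def)

text \<open>By additivity, \<open>rho\<close> and \<open>bracket\<close> at the zero section equal
  their own doubles. This removes the \<open>X 0\<close> term from \<open>ad_series\<close>.\<close>

lemma gla_bracket_zero_section:
  assumes D: "A_map D"
  shows "gla_bracket L 0 1 (cochain0 L 0) (cochain1 L D) = 0"
proof (rule eq_on_singletonsI)
  fix u assume u: "u \<in> rep_sections L"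
  have z: "0 \<in> alg_sections L"
    by (rule sections_zero[OF base_smooth alg_bundle])
  have "rho L 0 u = 0"
    using rho_add_left[OF z z u] by simp
  moreover have "bracket L 0 (app D u) = 0"
    using bracket_add(1)[OF z z app_A_map[OF D u]] by simp
  moreover have "app D 0 = 0"
    using linear_betw_zero[OF linear_app[OF D] rep_section_field[OF u]] .
  ultimately show "gla_bracket L 0 1 (cochain0 L 0) (cochain1 L D) [u] = 0 [u]"
    using gla_bracket_0_1[OF u] rho_section[OF z u] by (simp add: u cochain1_single)
qed (auto simp: gla_bracket_def)

text \<open>Only \<open>k = 0\<close> and \<open>k = 1\<close> contribute. In the latter,
  \<open>X 0\<close> paired with \<open>D 1\<close> vanishes and \<open>X 1\<close> paired with
  \<open>T\<close> remains; the minus sign comes from swapping the bracket.\<close>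

lemma exp_ad_1:
  assumes "A_map (D 1)" "D 0 = T" "X 0 = 0" "X 1 \<in> alg_sections L"
  shows "exp_ad L X (\<lambda>i. cochain1 L (D i)) 1 = cochain1 L (D 1) - d_T L T 0 (cochain0 L (X 1))"
  using gla_bracket_zero_section[OF assms(1)] gla_bracket_section[OF assms(4) T_map] assms(2,3)
  by (simp add: exp_ad_def ad_series_def cauchy_def d_T_def)

lemma exp_ad_0: "exp_ad L X P 0 = P 0"
  by (simp add: exp_ad_def)

text \<open>Acting by \<open>X\<close> subtracts the coboundary of \<open>X 1\<close> from the
  first-order coefficient, and every section of the algebroid occurs as \<open>X 1\<close>.\<close>

lemma deformation_equiv_1_iff:
  "(D, D') \<in> deformation_equiv L T 1 \<longleftrightarrow>
    D \<in> infinitesimal_deformations L T \<and> D' \<in> infinitesimal_deformations L T \<and>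
    (cochain1 L (D 1), cochain1 L (D' 1)) \<in> cohomologous L T 1"
proof (cases "D \<in> infinitesimal_deformations L T \<and> D' \<in> infinitesimal_deformations L T")
  case True
  then have D: "A_map (D 1)" "D 0 = T" "D' 0 = T"
    by (auto simp: infinitesimal_deformation_iff)
  have exp_iff: "(\<forall>l\<le>1. exp_ad L X (\<lambda>i. cochain1 L (D i)) l = cochain1 L (D' l)) \<longleftrightarrow>
      cochain1 L (D 1) - cochain1 L (D' 1) = d_T L T 0 (cochain0 L (X 1))"
    if "X 0 = 0" "X 1 \<in> alg_sections L" for X
  proof -
    \<comment> \<open>At order 0 both sides are \<open>cochain1 L T\<close>, so only order 1 is a
      condition.\<close>
    have "(\<forall>l\<le>1. exp_ad L X (\<lambda>i. cochain1 L (D i)) l = cochain1 L (D' l)) \<longleftrightarrow>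
        exp_ad L X (\<lambda>i. cochain1 L (D i)) 1 = cochain1 L (D' 1)"
      using D by (auto simp: exp_ad_0 le_Suc_eq)
    then show ?thesis
      unfolding exp_ad_1[OF D(1,2) that] by (metis diff_eq_eq add_diff_cancel_left' diff_add_cancel)
  qed
  have "(D, D') \<in> deformation_equiv L T 1 \<longleftrightarrow>
      (\<exists>X :: nat \<Rightarrow> 'm \<Rightarrow> 'a. X 0 = 0 \<and> range X \<subseteq> alg_sections L \<and>
        cochain1 L (D 1) - cochain1 L (D' 1) = d_T L T 0 (cochain0 L (X 1)))" (is "_ \<longleftrightarrow> ?ex")
    using True exp_iff unfolding deformation_equiv_def infinitesimal_deformations_def
    by (auto simp: image_subset_iff)
  also have "?ex \<longleftrightarrow> (\<exists>x \<in> alg_sections L.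
      cochain1 L (D 1) - cochain1 L (D' 1) = d_T L T 0 (cochain0 L x))"
  proof
    assume "\<exists>x \<in> alg_sections L. cochain1 L (D 1) - cochain1 L (D' 1) = d_T L T 0 (cochain0 L x)"
    then obtain x where "x \<in> alg_sections L"
      "cochain1 L (D 1) - cochain1 L (D' 1) = d_T L T 0 (cochain0 L x)" by blast
    \<comment> \<open>The witness is the series tx; its other coefficients are the zero
      section.\<close>
    then show ?ex
      using sections_zero[OF base_smooth alg_bundle] by (intro exI[of _ "\<lambda>i. if i = 1 then x else 0"]) auto
  qed blast
  \<comment> \<open>Degree 0 cochains are exactly the sections; both first-order coefficients are
    cocycles since \<open>D\<close> and \<open>D'\<close> are deformations.\<close>
  also have "\<dots> \<longleftrightarrow> (cochain1 L (D 1), cochain1 L (D' 1)) \<in> cohomologous L T 1"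
    using True image_infinitesimal_deformations
    by (auto simp: cohomologous_def coboundaries_def cochains_0)
  finally show ?thesis
    using True by simp
qed (auto simp: deformation_equiv_def infinitesimal_deformations_def)

end

section \<open>Passage to the quotients\<close>

text \<open>\<open>R\<close> is the pullback of \<open>S\<close> along \<open>f\<close>, so an
  \<open>R\<close>-class is the preimage of an \<open>S\<close>-class and is recovered from its
  image. Surjectivity of \<open>f\<close> onto \<open>B\<close> makes these images full
  \<open>S\<close>-classes and reaches all of them.\<close>

lemma bij_betw_quotient_image:
  assumes "f ` A = B" and R: "\<And>x y. (x, y) \<in> R \<longleftrightarrow> x \<in> A \<and> y \<in> A \<and> (f x, f y) \<in> S"
    and S: "S \<subseteq> B \<times> B"
  shows "bij_betw ((`) f) (A // R) (B // S)" "\<And>x. x \<in> A \<Longrightarrow> f ` (R `` {x}) = S `` {f x}"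
proof -
  show class_image: "f ` (R `` {x}) = S `` {f x}" if "x \<in> A" for x
    using that assms by (fastforce simp: R)
  have class_preimage: "R `` {x} = {y \<in> A. f y \<in> S `` {f x}}" if "x \<in> A" for x
    using that R by auto
  have "inj_on ((`) f) (A // R)"
  proof (rule inj_onI)
    fix C C' assume "C \<in> A // R" "C' \<in> A // R" and eq: "f ` C = f ` C'"
    then obtain x y where xy: "x \<in> A" "y \<in> A" "C = R `` {x}" "C' = R `` {y}"
      by (auto simp: quotient_def)
    have "S `` {f x} = S `` {f y}"
      using eq unfolding xy(3,4) class_image[OF xy(1)] class_image[OF xy(2)] .
    then show "C = C'"
      unfolding xy(3,4) class_preimage[OF xy(1)] class_preimage[OF xy(2)] by simp
  qed
  moreover have "(`) f ` (A // R) = B // S"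
    using assms(1) class_image by (auto simp: quotient_def image_iff)
  ultimately show "bij_betw ((`) f) (A // R) (B // S)"
    by (simp add: bij_betw_def)
qed

theorem theorem4p4:
  fixes L :: "('m::{t2_space, second_countable_topology}, 'a::real_vector, 'e::real_vector) lierep"
    and T :: "'m \<Rightarrow> 'e \<Rightarrow> 'a"
  assumes "lie_rep_pair L"
    and "relative_rota_baxter L T"
  shows "\<exists>\<Phi>. bij_betw \<Phi> (infinitesimal_deformations L T // deformation_equiv L T 1) (cohomology L T 1) \<and>
    (\<forall>D \<in> infinitesimal_deformations L T.
       \<Phi> (deformation_equiv L T 1 `` {D}) = cohomologous L T 1 `` {cochain1 L (D 1)})"
proof -
  have S: "cohomologous L T 1 \<subseteq> cocycles L T 1 \<times> cocycles L T 1"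
    by (auto simp: cohomologous_def)
  note q = bij_betw_quotient_image[OF image_infinitesimal_deformations[OF assms]
      deformation_equiv_1_iff[OF assms] S]
  show ?thesis
    \<comment> \<open>The bijection sends a class of deformations to the set of first-order
      coefficients of its members.\<close>
    using q by (intro exI[of _ "(`) (\<lambda>D. cochain1 L (D 1))"]) (simp add: cohomology_def)
qed

end
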